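(* Let $X_n$, $n\in\mathbb N$, be a sequence of non-empty Polish spaces and let $\psi_n:X_n^2\to\mathbb R^+$ be Borel functions such that the relation $E=E((X_n,\psi_n)_{n\in\mathbb N})$ on $\prod_{n\in\mathbb N}X_n$ is an equivalence relation. Then either $\mathbb R^{\mathbb N}/\ell_1\le_B E$, or $E_1\le_B E$, or $E\le_B E_0$.
   Context: $\mathbb R^+$ denotes the set of non-negative real numbers. For non-empty sets $X_n$ and functions $\psi_n:X_n^2\to\mathbb R^+$, the relation $E((X_n,\psi_n)_{n\in\mathbb N})$ on $\prod_{n\in\mathbb N}X_n$ is defined by $(x,y)\in E((X_n,\psi_n)_{n\in\mathbb N})\iff\sum_{n\in\mathbb N}\psi_n(x(n),y(n))<+\infty$. When the $X_n$ are Polish, $\prod_n X_n$ carries the product topology. For equivalence relations $E,F$ on Polish spaces $X,Y$, $E\le_B F$ means that there is a Borel function $\theta:X\to Y$ with $(x,y)\in E\iff(\theta(x),\theta(y))\in F$ for all $x,y\in X$. $\mathbb R^{\mathbb N}/\ell_1$ is the equivalence relation on $\mathbb R^{\mathbb N}$ given by $(x,y)\in\mathbb R^{\mathbb N}/\ell_1\iff x-y\in\ell_1$. $E_0$ is the equivalence relation on $2^{\mathbb N}$ given by $(x,y)\in E_0\iff\exists m\,\forall n\ge m\,(x(n)=y(n))$. $E_1$ is the equivalence relation on $2^{\mathbb N\times\mathbb N}$ given by $(x,y)\in E_1\iff\exists m\,\forall n\ge m\,\forall k\,(x(n,k)=y(n,k))$. *)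

theory Defs
  imports "HOL-Analysis.Analysis"
begin

(* The spaces X n vary with n, so they are modelled as abstract topologies whose carriers
   (topspace) are subsets of one type; the type class polish_space cannot be used for them. *)

definition Polish_topology :: "'a topology \<Rightarrow> bool" where
  "Polish_topology X \<longleftrightarrow> completely_metrizable_space X \<and> separable_space X"

definition borel_of :: "'a topology \<Rightarrow> 'a measure" where
  "borel_of X = sigma (topspace X) {U. openin X U}"

lemma space_borel_of [simp]: "space (borel_of X) = topspace X"
  by (simp add: borel_of_def space_measure_of_conv)

lemma sets_borel_of: "sets (borel_of X) = sigma_sets (topspace X) {U. openin X U}"
  unfolding borel_of_def by (rule sets_measure_of) (auto dest: openin_subset)

lemma sets_borel_of_euclidean: "sets (borel_of euclidean) = sets borel"
  by (simp add: borel_of_def borel_def)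

text \<open>\<open>E\<close> and \<open>F\<close> are intended to be equivalence relations on the carriers of the Polish
  topologies \<open>X\<close> and \<open>Y\<close>.\<close>

definition borel_reducible ::
    "'a topology \<Rightarrow> ('a \<times> 'a) set \<Rightarrow> 'b topology \<Rightarrow> ('b \<times> 'b) set \<Rightarrow> bool" where
  "borel_reducible X E Y F \<longleftrightarrow>
    (\<exists>\<theta> \<in> borel_of X \<rightarrow>\<^sub>M borel_of Y.
      \<forall>x \<in> topspace X. \<forall>y \<in> topspace X. (x, y) \<in> E \<longleftrightarrow> (\<theta> x, \<theta> y) \<in> F)"

text \<open>The functions \<open>\<psi> n\<close> are intended to be non-negative on \<open>X n \<times> X n\<close>, so that summability
  says that the sum of the series in \<open>[0, \<infinity>]\<close> is finite.\<close>

definition sum_rel ::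
    "(nat \<Rightarrow> 'a set) \<Rightarrow> (nat \<Rightarrow> 'a \<times> 'a \<Rightarrow> real) \<Rightarrow> ((nat \<Rightarrow> 'a) \<times> (nat \<Rightarrow> 'a)) set" where
  "sum_rel X \<psi> = {(x, y). x \<in> (\<Pi>\<^sub>E n\<in>UNIV. X n) \<and> y \<in> (\<Pi>\<^sub>E n\<in>UNIV. X n) \<and>
      summable (\<lambda>n. \<psi> n (x n, y n))}"

definition ell1 :: "(nat \<Rightarrow> real) set" where
  "ell1 = {z. summable (\<lambda>n. \<bar>z n\<bar>)}"

definition real_seq_mod_ell1 :: "((nat \<Rightarrow> real) \<times> (nat \<Rightarrow> real)) set" where
  "real_seq_mod_ell1 = {(x, y). (\<lambda>n. x n - y n) \<in> ell1}"

definition real_seq_topology :: "(nat \<Rightarrow> real) topology" where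
  "real_seq_topology = product_topology (\<lambda>_. euclidean) UNIV"

definition cantor_topology :: "('i \<Rightarrow> bool) topology" where
  "cantor_topology = product_topology (\<lambda>_. discrete_topology UNIV) UNIV"

definition E0 :: "((nat \<Rightarrow> bool) \<times> (nat \<Rightarrow> bool)) set" where
  "E0 = {(x, y). \<exists>m. \<forall>n\<ge>m. x n = y n}"

definition E1 :: "((nat \<times> nat \<Rightarrow> bool) \<times> (nat \<times> nat \<Rightarrow> bool)) set" where
  "E1 = {(x, y). \<exists>m. \<forall>n\<ge>m. \<forall>k. x (n, k) = y (n, k)}"

end

theory Submission
  imports Defs
begin

text \<open>
  Either arbitrarily small weights \<open>\<psi> n (u n, v n)\<close> with a divergent sum can be found at every scale, or
  for some \<open>\<delta> > 0\<close> the weights below \<open>\<delta>\<close> always have a finite sum. In the first case disjoint blocks of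
  coordinates of total weight about \<open>2^-n\<close> carry the bits \<open>x n > k / 2^n\<close>, which embeds
  \<open>\<real>^\<nat> / l\<^sub>1\<close>. In the second case \<open>E\<close> says that the relations \<open>R n = {\<psi> n \<le> \<delta>}\<close> hold for all large
  \<open>n\<close>, and these are eventually equivalence relations. By Silver's theorem each \<open>R n\<close> has countably many
  classes or a Cantor set of inequivalent points; infinitely many Cantor sets embed \<open>E1\<close>, while countably
  many classes almost everywhere allow a one-hot coding into \<open>E0\<close>.

  Silver's theorem is proved without forcing or transfinite recursion. Call a set of finite configurations
  large if every countable family of classes is avoided by one of them; the sets that are not large form a
  \<open>\<sigma>\<close>-ideal, and a large set stays large when its configurations are joined in pairs along a new
  inequivalent edge. A fusion of large sets of shrinking diameter gives a continuous map on the Cantor space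
  sending the edges of the graph \<open>G\<^sub>0\<close> to inequivalent pairs. The pulled back relation has the Baire
  property, so it is meager, and Mycielski's theorem applies.
\<close>

section \<open>Suslin sets\<close>

text \<open>Sequential closedness in the product of Baire space with \<open>W\<close>; convergence
  in Baire space means that every coordinate is eventually constant. This is the form in which the
  fusion passes to a limit.\<close>

definition seq_closed :: "'b topology \<Rightarrow> ((nat \<Rightarrow> nat) \<times> 'b) set \<Rightarrow> bool" where
  "seq_closed W C \<longleftrightarrow> (\<forall>a w \<alpha> l. (\<forall>i. (a i, w i) \<in> C) \<longrightarrow>
      (\<forall>k. \<exists>N. \<forall>i\<ge>N. a i k = \<alpha> k) \<longrightarrow> limitin W w l sequentially \<longrightarrow> (\<alpha>, l) \<in> C)"

lemma seq_closedD:
  assumes "seq_closed W C" "\<And>i. (a i, w i) \<in> C" "\<And>k. \<exists>N. \<forall>i\<ge>N. a i k = \<alpha> k"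
    "limitin W w l sequentially"
  shows "(\<alpha>, l) \<in> C"
  using assms unfolding seq_closed_def by blast

text \<open>The analytic sets, as projections of closed sets along Baire space. A witness
  \<open>a\<close> can be fixed entry by entry, which is how inequivalence survives the limit of the
  fusion.\<close>

definition suslin :: "'b topology \<Rightarrow> 'b set \<Rightarrow> bool" where
  "suslin W A \<longleftrightarrow> (\<exists>C. seq_closed W C \<and> A = {w \<in> topspace W. \<exists>a. (a, w) \<in> C})"

lemma suslin_closedin:
  assumes "closedin W F"
  shows "suslin W F"
  unfolding suslin_def
proof (intro exI conjI)
  show "seq_closed W (UNIV \<times> F)"
    unfolding seq_closed_def using limitin_closedin[OF _ assms]
    by (metis UNIV_I SigmaE2 SigmaI always_eventually trivial_limit_sequentially)
  show "F = {w \<in> topspace W. \<exists>a. (a, w) \<in> UNIV \<times> F}"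
    using closedin_subset[OF assms] by auto
qed

text \<open>Entry \<open>0\<close> of a witness names the member of the union and the remaining
  entries witness membership in it. Along a convergent sequence entry \<open>0\<close> is eventually
  constant, so a tail stays in one closed set.\<close>

lemma suslin_Union:
  assumes "\<And>n::nat. suslin W (A n)"
  shows "suslin W (\<Union>n. A n)"
proof -
  have "\<forall>n. \<exists>C. seq_closed W C \<and> A n = {w \<in> topspace W. \<exists>a. (a, w) \<in> C}"
    using assms unfolding suslin_def by blast
  from choice[OF this] obtain C where C: "\<And>n. seq_closed W (C n)"
    and A: "\<And>n. A n = {w \<in> topspace W. \<exists>a. (a, w) \<in> C n}"
    by blast
  define D where "D = {(a, w). (\<lambda>i. a (Suc i), w) \<in> C (a 0)}"
  have "seq_closed W D"
    unfolding seq_closed_def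
  proof (intro allI impI)
    fix a w \<alpha> l
    assume D: "\<forall>i. (a i, w i) \<in> D" and a: "\<forall>k. \<exists>N. \<forall>i\<ge>N. a i k = \<alpha> k"
      and l: "limitin W w l sequentially"
    obtain N where N: "\<forall>i\<ge>N. a i 0 = \<alpha> 0" using a by blast
    have "(\<lambda>i. \<alpha> (Suc i), l) \<in> C (\<alpha> 0)"
    proof (rule seq_closedD[OF C, where a = "\<lambda>i k. a (i + N) (Suc k)" and w = "\<lambda>i. w (i + N)"])
      show "(\<lambda>k. a (i + N) (Suc k), w (i + N)) \<in> C (\<alpha> 0)" for i
        using D[rule_format, of "i + N"] N by (simp add: D_def)
      show "\<exists>M. \<forall>i\<ge>M. a (i + N) (Suc k) = \<alpha> (Suc k)" for k
        using a by (meson trans_le_add1)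
      show "limitin W (\<lambda>i. w (i + N)) l sequentially"
        using l by (rule limitin_sequentially_offset)
    qed
    then show "(\<alpha>, l) \<in> D" by (simp add: D_def)
  qed
  moreover have "(\<Union>n. A n) = {w \<in> topspace W. \<exists>a. (a, w) \<in> D}"
  proof (intro set_eqI iffI)
    fix w assume "w \<in> (\<Union>n. A n)"
    then obtain n a where "w \<in> topspace W" "(a, w) \<in> C n" by (auto simp: A)
    then have "(case_nat n a, w) \<in> D" by (simp add: D_def)
    with \<open>w \<in> topspace W\<close> show "w \<in> {w \<in> topspace W. \<exists>a. (a, w) \<in> D}" by blast
  qed (auto simp: A D_def)
  ultimately show ?thesis unfolding suslin_def by blast
qed

text \<open>One sequence interleaves witnesses for all members through \<open>prod_encode\<close>;
  coordinatewise convergence passes to each of them.\<close>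

lemma suslin_Inter:
  assumes "\<And>n::nat. suslin W (A n)"
  shows "suslin W (\<Inter>n. A n)"
proof -
  have "\<forall>n. \<exists>C. seq_closed W C \<and> A n = {w \<in> topspace W. \<exists>a. (a, w) \<in> C}"
    using assms unfolding suslin_def by blast
  from choice[OF this] obtain C where C: "\<And>n. seq_closed W (C n)"
    and A: "\<And>n. A n = {w \<in> topspace W. \<exists>a. (a, w) \<in> C n}"
    by blast
  define D where "D = {(a, w). \<forall>n. (\<lambda>i. a (prod_encode (n, i)), w) \<in> C n}"
  have "seq_closed W D"
    unfolding seq_closed_def
  proof (intro allI impI)
    fix a w \<alpha> l
    assume D: "\<forall>i. (a i, w i) \<in> D" and a: "\<forall>k. \<exists>N. \<forall>i\<ge>N. a i k = \<alpha> k"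
      and l: "limitin W w l sequentially"
    have "(\<lambda>i. \<alpha> (prod_encode (n, i)), l) \<in> C n" for n
      using D a by (intro seq_closedD[OF C _ _ l, where a = "\<lambda>i k. a i (prod_encode (n, k))"])
        (auto simp: D_def)
    then show "(\<alpha>, l) \<in> D" by (simp add: D_def)
  qed
  moreover have "(\<Inter>n. A n) = {w \<in> topspace W. \<exists>a. (a, w) \<in> D}"
  proof (intro set_eqI iffI)
    fix w assume "w \<in> (\<Inter>n. A n)"
    then have "w \<in> topspace W" "\<forall>n. \<exists>a. (a, w) \<in> C n" by (auto simp: A)
    moreover from choice[OF this(2)] obtain a where "\<And>n. (a n, w) \<in> C n" by blast
    then have "(\<lambda>j. a (fst (prod_decode j)) (snd (prod_decode j)), w) \<in> D" by (simp add: D_def)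
    ultimately show "w \<in> {w \<in> topspace W. \<exists>a. (a, w) \<in> D}" by blast
  qed (auto simp: A D_def)
  ultimately show ?thesis unfolding suslin_def by blast
qed

lemma suslin_openin:
  assumes "metrizable_space W" "openin W U"
  shows "suslin W U"
proof -
  have "fsigma_in W U"
    using assms by (rule open_imp_fsigma_in)
  then obtain C where "\<And>n::nat. closedin W (C n)" "\<Union>(range C) = U"
    unfolding fsigma_in_ascending by auto
  then show ?thesis
    using suslin_Union[of W C] suslin_closedin by auto
qed

text \<open>A set and its complement go through the induction together: complementation swaps the
  two claims, and a countable union uses \<open>suslin_Union\<close> for one and
  \<open>suslin_Inter\<close> for the other.\<close>

lemma suslin_borel_of:
  assumes "metrizable_space W" "A \<in> sets (borel_of W)"
  shows "suslin W A \<and> suslin W (topspace W - A)"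
  using assms(2) unfolding sets_borel_of
proof (induction rule: sigma_sets.induct)
  case (Basic U)
  then show ?case
    using suslin_openin[OF assms(1)] by (auto intro: suslin_closedin)
next
  case Empty
  then show ?case by (simp add: suslin_closedin)
next
  case (Compl A)
  have "suslin W A \<Longrightarrow> suslin W (topspace W - (topspace W - A))"
  proof -
    assume "suslin W A"
    then have "A \<subseteq> topspace W" unfolding suslin_def by blast
    then show ?thesis using \<open>suslin W A\<close> by (simp add: double_diff)
  qed
  with Compl show ?case by blast
next
  case (Union A)
  have "suslin W (\<Union>n. A n)"
    by (rule suslin_Union) (use Union.IH in blast)
  moreover have "suslin W (\<Inter>n. topspace W - A n)"
    by (rule suslin_Inter) (use Union.IH in blast)
  moreover have "topspace W - (\<Union>n. A n) = (\<Inter>n. topspace W - A n)" by auto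
  ultimately show ?case by argo
qed

section \<open>Large sets of configurations\<close>

text \<open>Functions on words of length \<open>n\<close> are kept as functions on infinite
  sequences, so that configurations of all levels share one type.\<close>

definition depends :: "nat \<Rightarrow> ((nat \<Rightarrow> bool) \<Rightarrow> 'b) \<Rightarrow> bool" where
  "depends n f \<longleftrightarrow> (\<forall>x y. (\<forall>i<n. x i = y i) \<longrightarrow> f x = f y)"

lemma dependsD: "depends n f \<Longrightarrow> (\<And>i. i < n \<Longrightarrow> x i = y i) \<Longrightarrow> f x = f y"
  unfolding depends_def by blast

lemma finite_zero_beyond: "finite {x :: nat \<Rightarrow> bool. \<forall>i\<ge>n. \<not> x i}"
proof (rule finite_subset)
  show "{x. \<forall>i\<ge>n. \<not> x i} \<subseteq> (\<lambda>A i. i \<in> A) ` Pow {..<n}"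
  proof
    fix x :: "nat \<Rightarrow> bool" assume "x \<in> {x. \<forall>i\<ge>n. \<not> x i}"
    then have "x = (\<lambda>i. i \<in> Collect x)" "Collect x \<in> Pow {..<n}"
      by (auto simp: not_le[symmetric])
    then show "x \<in> (\<lambda>A i. i \<in> A) ` Pow {..<n}" by blast
  qed
qed simp

text \<open>A function of the first \<open>n\<close> bits is determined by its values on the
  finitely many sequences that vanish from \<open>n\<close> on.\<close>

lemma countable_depends: "countable {f :: (nat \<Rightarrow> bool) \<Rightarrow> 'b :: countable. depends n f}"
proof -
  let ?B = "{x :: nat \<Rightarrow> bool. \<forall>i\<ge>n. \<not> x i}"
  have "(\<lambda>f. restrict f B) ` F \<subseteq> PiE B (\<lambda>_. UNIV :: 'b set)"
    for F and B :: "(nat \<Rightarrow> bool) set"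
    by auto
  moreover have "countable (PiE ?B (\<lambda>_. UNIV :: 'b set))"
    by (rule countable_PiE[OF finite_zero_beyond]) simp
  ultimately have "countable ((\<lambda>f. restrict f ?B) ` {f :: (nat \<Rightarrow> bool) \<Rightarrow> 'b. depends n f})"
    by (rule countable_subset)
  moreover have "inj_on (\<lambda>f. restrict f ?B) {f :: (nat \<Rightarrow> bool) \<Rightarrow> 'b. depends n f}"
  proof (intro inj_onI ext)
    fix f g :: "(nat \<Rightarrow> bool) \<Rightarrow> 'b" and x
    assume fg: "f \<in> {f. depends n f}" "g \<in> {f. depends n f}" and eq: "restrict f ?B = restrict g ?B"
    let ?x = "\<lambda>i. i < n \<and> x i"
    have "f x = f ?x" "g x = g ?x" 
      using fg dependsD[of n f x ?x] dependsD[of n g x ?x] by simp_all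
    moreover have "f ?x = g ?x" using fun_cong[OF eq, of ?x] by simp
    ultimately show "f x = g x" by simp
  qed
  ultimately show ?thesis
    by (rule countable_image_inj_on)
qed

text \<open>\<open>C\<close> is a closed set projecting onto the inequivalent pairs. The first
  \<open>k\<close> bits of \<open>s k\<close> form the word that precedes the flipped bit
  \<open>k\<close> on an edge of \<open>G\<^sub>0\<close>.\<close>

locale fusion = Metric_space M d for M :: "'a set" and d +
  fixes R :: "('a \<times> 'a) set" and C :: "((nat \<Rightarrow> nat) \<times> 'a \<times> 'a) set" and s :: "nat \<Rightarrow> nat \<Rightarrow> bool"
  assumes complete: mcomplete
    and separable: "separable_space mtopology"
    and equivR: "equiv M R"
    and uncountable_quotient: "uncountable (M // R)"
    and closedC: "seq_closed (prod_topology mtopology mtopology) C"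
    and C: "M \<times> M - R = {w \<in> M \<times> M. \<exists>a. (a, w) \<in> C}"
begin

text \<open>A configuration of level \<open>n\<close> consists of a point for each binary word of length \<open>n\<close> and, for
  each edge flipping the bit after the initial segment \<open>s k\<close>, a witness that the endpoints are
  inequivalent. Words are represented by infinite sequences whose further bits are ignored.\<close>

definition config :: "nat \<Rightarrow> ((nat \<Rightarrow> bool) \<Rightarrow> 'a) \<times> (nat \<Rightarrow> (nat \<Rightarrow> bool) \<Rightarrow> nat \<Rightarrow> nat) \<Rightarrow> bool" where
  "config n c \<longleftrightarrow> depends n (fst c) \<and> range (fst c) \<subseteq> M \<and> (\<forall>k<n. depends n (snd c k)) \<and>
    (\<forall>k<n. \<forall>x. (\<forall>i<k. x i = s k i) \<longrightarrow> \<not> x k \<longrightarrow> (snd c k x, fst c x, fst c (x(k := True))) \<in> C)"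

lemma
  assumes "config n c"
  shows config_in: "fst c x \<in> M"
    and config_fst_eq: "\<forall>i<n. x i = y i \<Longrightarrow> fst c x = fst c y"
    and config_snd_eq: "k < n \<Longrightarrow> \<forall>i<n. x i = y i \<Longrightarrow> snd c k x = snd c k y"
    and config_edge: "k < n \<Longrightarrow> \<forall>i<k. x i = s k i \<Longrightarrow> \<not> x k \<Longrightarrow>
      (snd c k x, fst c x, fst c (x(k := True))) \<in> C"
  using assms dependsD[of n "fst c" x y] dependsD[of n "snd c k" x y]
  by (auto simp: config_def simp del: fun_upd_apply)

text \<open>The bounds are tuned for the limit: distances decrease geometrically, and every entry of
  every witness is frozen from some level on.\<close>

definition close :: "nat \<Rightarrow> ((nat \<Rightarrow> bool) \<Rightarrow> 'a) \<times> (nat \<Rightarrow> (nat \<Rightarrow> bool) \<Rightarrow> nat \<Rightarrow> nat) \<Rightarrow>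
    ((nat \<Rightarrow> bool) \<Rightarrow> 'a) \<times> (nat \<Rightarrow> (nat \<Rightarrow> bool) \<Rightarrow> nat \<Rightarrow> nat) \<Rightarrow> bool" where
  "close n c c' \<longleftrightarrow> (\<forall>x. d (fst c x) (fst c' x) \<le> 1 / 2 ^ n \<and>
    (\<forall>k<n. \<forall>i<n. snd c k x i = snd c' k x i))"

definition avoids :: "'a set set \<Rightarrow> ((nat \<Rightarrow> bool) \<Rightarrow> 'a) \<times> (nat \<Rightarrow> (nat \<Rightarrow> bool) \<Rightarrow> nat \<Rightarrow> nat) \<Rightarrow> bool" where
  "avoids D c \<longleftrightarrow> (\<forall>x. fst c x \<notin> \<Union>D)"

definition large :: "(((nat \<Rightarrow> bool) \<Rightarrow> 'a) \<times> (nat \<Rightarrow> (nat \<Rightarrow> bool) \<Rightarrow> nat \<Rightarrow> nat)) set \<Rightarrow> bool" where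
  "large S \<longleftrightarrow> (\<forall>D. countable D \<longrightarrow> D \<subseteq> M // R \<longrightarrow> (\<exists>c\<in>S. avoids D c))"

lemma large_avoids: "large S \<Longrightarrow> countable D \<Longrightarrow> D \<subseteq> M // R \<Longrightarrow> \<exists>c\<in>S. avoids D c"
  by (simp add: large_def)

text \<open>If no piece were large, each would fail against some countable family of classes. The
  union of these families over the countably many codes is countable and would defeat
  \<open>S\<close> itself.\<close>

lemma large_piece:
  assumes "large S" "countable (code ` S)"
  shows "\<exists>q. large {c \<in> S. code c = q}"
proof (rule ccontr)
  assume "\<not> ?thesis"
  then have not_large: "\<not> large {c \<in> S. code c = q}" for q by simp
  define P where "P q D \<longleftrightarrow> countable D \<and> D \<subseteq> M // R \<and>
    \<not> (\<exists>c\<in>{c \<in> S. code c = q}. avoids D c)" for q D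
  have "\<exists>D. P q D" for q
    using not_large[of q] unfolding large_def P_def by (simp only: not_all not_imp)
  then have P: "P q (SOME D. P q D)" for q
    by (rule someI_ex)
  define D where "D q = (SOME D. P q D)" for q
  have D: "P q (D q)" for q
    unfolding D_def by (rule P)
  let ?D = "\<Union>q\<in>code ` S. D q"
  have "countable ?D"
    by (rule countable_UN[OF assms(2)]) (use D in \<open>simp add: P_def\<close>)
  moreover have "?D \<subseteq> M // R"
    by (rule UN_least) (use D in \<open>simp add: P_def\<close>)
  ultimately obtain c where c: "c \<in> S" "avoids ?D c"
    using large_avoids[OF assms(1)] by blast
  then have "avoids (D (code c)) c"
    unfolding avoids_def by blast
  with c(1) D[of "code c"] show False
    unfolding P_def by blast
qed

text \<open>Countably many codes suffice: for each word the index of a nearby point of a countable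
  dense set, together with the first \<open>n\<close> entries of the \<open>n\<close> witnesses.
  Configurations with equal codes are close.\<close>

lemma large_close_piece:
  assumes "large S" and conf: "\<And>c. c \<in> S \<Longrightarrow> config n c"
  shows "\<exists>T\<subseteq>S. large T \<and> (\<forall>c\<in>T. \<forall>c'\<in>T. close n c c')"
proof -
  obtain Q where Q: "countable Q" "Q \<subseteq> M" "mtopology closure_of Q = M"
    using separable unfolding separable_space_def by auto
  \<comment> \<open>Half of the allowed distance, so that two points near the same dense point are
    within \<open>1 / 2 ^ n\<close> of each other.\<close>
  have "\<exists>j. from_nat_into Q j \<in> M \<and> d (from_nat_into Q j) u < 1 / 2 ^ Suc n" if "u \<in> M" for u
  proof -
    have "u \<in> mtopology closure_of Q" using Q(3) that by simp
    moreover have "(0 :: real) < 1 / 2 ^ Suc n" by simp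
    ultimately obtain v where v: "v \<in> Q" "v \<in> mball u (1 / 2 ^ Suc n)"
      unfolding metric_closure_of by blast
    moreover obtain j where "v = from_nat_into Q j"
      using Q(1) v(1) by (metis from_nat_into_to_nat_on)
    ultimately have "from_nat_into Q j \<in> M \<and> d (from_nat_into Q j) u < 1 / 2 ^ Suc n"
      by (simp add: commute del: power_Suc)
    then show ?thesis by (rule exI)
  qed
  then have "\<forall>u\<in>M. \<exists>j. from_nat_into Q j \<in> M \<and> d (from_nat_into Q j) u < 1 / 2 ^ Suc n"
    by (rule ballI)
  from bchoice[OF this] obtain h
    where "\<forall>u\<in>M. from_nat_into Q (h u) \<in> M \<and> d (from_nat_into Q (h u)) u < 1 / 2 ^ Suc n"
    by (rule exE)
  then have h: "\<And>u. u \<in> M \<Longrightarrow> from_nat_into Q (h u) \<in> M"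
    "\<And>u. u \<in> M \<Longrightarrow> d (from_nat_into Q (h u)) u < 1 / 2 ^ Suc n"
    by simp_all
  define code where "code c x = (h (fst c x), map (\<lambda>k. map (snd c k x) [0..<n]) [0..<n])"
    for c :: "((nat \<Rightarrow> bool) \<Rightarrow> 'a) \<times> (nat \<Rightarrow> (nat \<Rightarrow> bool) \<Rightarrow> nat \<Rightarrow> nat)" and x
  have dep: "depends n (code c)" if "c \<in> S" for c
    unfolding depends_def
  proof (intro allI impI)
    fix x y :: "nat \<Rightarrow> bool" assume "\<forall>i<n. x i = y i"
    then have "fst c x = fst c y" "\<And>k. k < n \<Longrightarrow> snd c k x = snd c k y"
      using config_fst_eq[OF conf[OF that]] config_snd_eq[OF conf[OF that]] by simp_all
    then show "code c x = code c y" by (simp add: code_def)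
  qed
  have "code ` S \<subseteq> {q. depends n q}"
    using dep by (intro image_subsetI) simp
  then have "countable (code ` S)"
    by (rule countable_subset[OF _ countable_depends])
  from large_piece[OF assms(1) this] obtain q where q: "large {c \<in> S. code c = q}"
    by (rule exE)
  have "close n c c'" if "c \<in> S" "c' \<in> S" "code c = code c'" for c c'
    unfolding close_def
  proof (intro allI conjI impI)
    fix x
    have M: "fst c x \<in> M" "fst c' x \<in> M" 
      using config_in[OF conf[OF that(1)]] config_in[OF conf[OF that(2)]] by simp_all
    have eq: "h (fst c x) = h (fst c' x)"
      "map (\<lambda>k. map (snd c k x) [0..<n]) [0..<n] = map (\<lambda>k. map (snd c' k x) [0..<n]) [0..<n]"
      using fun_cong[OF that(3), of x] by (auto simp: code_def)
    have "d (fst c x) (fst c' x) \<le>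
        d (from_nat_into Q (h (fst c x))) (fst c x) + d (from_nat_into Q (h (fst c x))) (fst c' x)"
      using triangle''[OF M(1) h(1)[OF M(1)] M(2)] M by (simp add: commute)
    also have "\<dots> \<le> 1 / 2 ^ Suc n + 1 / 2 ^ Suc n"
      using h(2)[OF M(1)] h(2)[OF M(2)] eq(1) by (simp del: power_Suc)
    finally show "d (fst c x) (fst c' x) \<le> 1 / 2 ^ n" by simp
    fix k i assume "k < n" "i < n"
    then show "snd c k x i = snd c' k x i"
      using eq(2) by simp
  qed
  then show ?thesis
    using q by (intro exI[of _ "{c \<in> S. code c = q}"] conjI) simp_all
qed

section \<open>Doubling of configurations and the fusion sequence\<close>

text \<open>Bit \<open>n\<close> selects the half. Only one edge of kind \<open>n\<close> exists at
  level \<open>Suc n\<close>, the one at the word \<open>s n\<close>, so a single witness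
  \<open>a\<close> serves it.\<close>

definition glue where
  "glue n a c c' = ((\<lambda>x. if x n then fst c' x else fst c x),
    (\<lambda>k x. if k = n then a else if x n then snd c' k x else snd c k x))"
  for n :: nat and a :: "nat \<Rightarrow> nat"
    and c c' :: "((nat \<Rightarrow> bool) \<Rightarrow> 'a) \<times> (nat \<Rightarrow> (nat \<Rightarrow> bool) \<Rightarrow> nat \<Rightarrow> nat)"

definition double where
  "double n S = {glue n a c c' | a c c'. c \<in> S \<and> c' \<in> S \<and> (a, fst c (s n), fst c' (s n)) \<in> C}"

text \<open>Edges of kind \<open>k < n\<close> do not change bit \<open>n\<close> and stay inside
  one half; the edge of kind \<open>n\<close> joins the halves and is witnessed by
  \<open>a\<close>.\<close>

lemma config_double:
  assumes conf: "\<And>c. c \<in> S \<Longrightarrow> config n c" and "e \<in> double n S"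
  shows "config (Suc n) e"
proof -
  from assms(2) obtain a c c' where e: "e = glue n a c c'" and "c \<in> S" "c' \<in> S"
    and a: "(a, fst c (s n), fst c' (s n)) \<in> C"
    unfolding double_def by blast
  then have c: "config n c" "config n c'"
    by (simp_all add: conf)
  have 1: "fst c x = fst c y" "fst c' x = fst c' y" if "\<forall>i<n. x i = y i" for x y
    using config_fst_eq[OF c(1) that] config_fst_eq[OF c(2) that] by simp_all
  have 2: "snd c k x = snd c k y" "snd c' k x = snd c' k y" if "k < n" "\<forall>i<n. x i = y i" for k x y
    using config_snd_eq[OF c(1) that] config_snd_eq[OF c(2) that] by simp_all
  have "(snd e k x, fst e x, fst e (x(k := True))) \<in> C"
    if "k < Suc n" "\<forall>i<k. x i = s k i" "\<not> x k" for k x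
  proof (cases "k = n")
    case True
    then have "fst c x = fst c (s n)" "fst c' (x(n := True)) = fst c' (s n)"
      
      using that 1(1)[of x "s n"] 1(2)[of "x(n := True)" "s n"] by simp_all
    with a True that(3) show ?thesis by (simp add: e glue_def)
  next
    case False
    then have "k < n" using that by simp
    then show ?thesis
      using config_edge[OF c(1) \<open>k < n\<close> that(2,3)] config_edge[OF c(2) \<open>k < n\<close> that(2,3)] False
      by (simp add: e glue_def)
  qed
  moreover have "depends (Suc n) (fst e)"
    unfolding depends_def
    using 1 by (simp add: e glue_def)
  moreover have "depends (Suc n) (snd e k)" if "k < Suc n" for k
    unfolding depends_def
    using 2[of k] that by (simp add: e glue_def)
  moreover have "range (fst e) \<subseteq> M"
    using config_in[OF c(1)] config_in[OF c(2)] by (simp add: e glue_def image_subset_iff)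
  ultimately show ?thesis unfolding config_def by blast
qed

text \<open>First \<open>c\<close> is chosen to avoid \<open>D\<close>, then \<open>c'\<close> to
  avoid \<open>D\<close> and also the class of the point of \<open>c\<close> at \<open>s n\<close>.
  The new edge is then inequivalent, so \<open>C\<close> supplies its witness, and both halves avoid
  \<open>D\<close>.\<close>

lemma large_double:
  assumes "large S" and conf: "\<And>c. c \<in> S \<Longrightarrow> config n c"
  shows "large (double n S)"
  unfolding large_def
proof (intro allI impI)
  fix D assume D: "countable D" "D \<subseteq> M // R"
  obtain c where c: "c \<in> S" "avoids D c"
    using large_avoids[OF assms(1) D] by (rule bexE)
  have cM: "fst c (s n) \<in> M" using config_in[OF conf[OF c(1)]] .
  let ?D = "insert (R `` {fst c (s n)}) D"
  have "countable ?D" "?D \<subseteq> M // R"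
    using D quotientI[OF cM, of R] by simp_all
  from large_avoids[OF assms(1) this] obtain c' where c': "c' \<in> S" "avoids ?D c'"
    by (rule bexE)
  have "fst c' (s n) \<in> M" using config_in[OF conf[OF c'(1)]] .
  moreover have "(fst c (s n), fst c' (s n)) \<notin> R"
    using c'(2) by (simp add: avoids_def)
  ultimately have "(fst c (s n), fst c' (s n)) \<in> {w \<in> M \<times> M. \<exists>a. (a, w) \<in> C}"
    using cM unfolding C[symmetric] by simp
  then obtain a where "(a, fst c (s n), fst c' (s n)) \<in> C" by blast
  then have "glue n a c c' \<in> double n S"
    using c(1) c'(1) unfolding double_def
    by (intro CollectI exI[of _ a] exI[of _ c] exI[of _ c'] conjI refl)
  moreover have "avoids D (glue n a c c')"
    using c(2) c'(2) by (simp add: avoids_def glue_def)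
  ultimately show "\<exists>c\<in>double n S. avoids D c" by (rule bexI[rotated])
qed

text \<open>At level \<open>0\<close> there is one word and no edge, so a configuration is a point
  with dummy witnesses \<open>0\<close>. Countably many classes cannot exhaust an uncountable
  quotient.\<close>

lemma large_initial: "large ((\<lambda>u. (\<lambda>_. u, \<lambda>_ _ _. 0)) ` M)"
  unfolding large_def
proof (intro allI impI)
  fix D assume D: "countable D" "D \<subseteq> M // R"
  then have "\<not> M // R \<subseteq> D"
    using uncountable_quotient countable_subset by metis
  then obtain A where A: "A \<in> M // R" "A \<notin> D" by (meson subsetI)
  then obtain u where u: "u \<in> A" "u \<in> M"
    using in_quotient_imp_non_empty[OF equivR A(1)] in_quotient_imp_subset[OF equivR A(1)] by blast
  have "u \<notin> B" if "B \<in> D" for B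
  proof
    assume "u \<in> B"
    then have "A = B"
      using quotient_disj[OF equivR A(1) subsetD[OF D(2) that]] u(1) by blast
    with A(2) that show False by simp
  qed
  then have "u \<notin> \<Union>D" by simp
  then show "\<exists>c\<in>((\<lambda>u. (\<lambda>_. u, \<lambda>_ _ _. 0)) ` M). avoids D c"
    by (intro bexI[OF _ imageI[OF u(2)]]) (simp add: avoids_def)
qed

definition stage where
  "stage n S \<longleftrightarrow> large S \<and> (\<forall>c\<in>S. config n c) \<and> (\<forall>c\<in>S. \<forall>c'\<in>S. close n c c')"

text \<open>Doubling alternates with shrinking to a close piece; both preserve largeness.\<close>

lemma stages: "\<exists>S. \<forall>n. stage n (S n) \<and> S (Suc n) \<subseteq> double n (S n)"
proof (rule dependent_nat_choice)
  let ?S = "((\<lambda>u. (\<lambda>_. u, \<lambda>_ _ _. 0)) ` M)"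
  have "config 0 c" if "c \<in> ?S" for c
    using that by (auto simp: config_def depends_def)
  from large_close_piece[OF large_initial this] obtain T
    where T: "T \<subseteq> ?S" "large T" "\<forall>c\<in>T. \<forall>c'\<in>T. close 0 c c'"
    by blast
  have "\<forall>c\<in>T. config 0 c"
    by (intro ballI \<open>\<And>c. c \<in> ?S \<Longrightarrow> config 0 c\<close> subsetD[OF T(1)])
  with T(2,3) have "stage 0 T"
    unfolding stage_def by (intro conjI)
  then show "\<exists>S. stage 0 S" by (rule exI)
next
  fix S n assume S: "stage n S"
  then have conf: "\<And>c. c \<in> S \<Longrightarrow> config n c" and "large S"
    by (simp_all add: stage_def)
  have conf': "\<And>c. c \<in> double n S \<Longrightarrow> config (Suc n) c"
    by (rule config_double[OF conf])
  obtain T where T: "T \<subseteq> double n S" "large T" "\<forall>c\<in>T. \<forall>c'\<in>T. close (Suc n) c c'"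
    using large_close_piece[OF large_double[OF \<open>large S\<close> conf] conf'] by blast
  have "\<forall>c\<in>T. config (Suc n) c"
    by (intro ballI conf' subsetD[OF T(1)])
  with T have "stage (Suc n) T \<and> T \<subseteq> double n S"
    unfolding stage_def by (intro conjI)
  then show "\<exists>T. stage (Suc n) T \<and> T \<subseteq> double n S" by (rule exI)
qed

text \<open>One configuration is picked from each stage. Its points form Cauchy sequences, its
  witnesses stabilise entrywise, and closedness of \<open>C\<close> carries the inequivalence of
  every edge to the limit.\<close>

lemma homomorphism:
  "\<exists>\<phi>. range \<phi> \<subseteq> M \<and> (\<forall>n x y. (\<forall>i<n. x i = y i) \<longrightarrow> d (\<phi> x) (\<phi> y) \<le> 4 / 2 ^ n) \<and>
    (\<forall>k x. (\<forall>i<k. x i = s k i) \<longrightarrow> \<not> x k \<longrightarrow> (\<phi> x, \<phi> (x(k := True))) \<notin> R)"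
proof -
  obtain S where S: "\<And>n. stage n (S n)" "\<And>n. S (Suc n) \<subseteq> double n (S n)"
    using stages by blast
  \<comment> \<open>Avoiding the empty family is enough to produce a member.\<close>
  have "\<exists>c. c \<in> S n" for n
    using S(1)[of n] unfolding stage_def large_def by (meson countable_empty empty_subsetI)
  then obtain c where c: "\<And>n. c n \<in> S n" by metis
  define p where "p n = fst (c n)" for n
  define w where "w n = snd (c n)" for n
  have conf: "config n (c n)" for n using S(1) c unfolding stage_def by blast
  have pM: "p n x \<in> M" for n x unfolding p_def by (rule config_in[OF conf])
  have pdep: "p n x = p n y" if "\<forall>i<n. x i = y i" for n x y
    unfolding p_def by (rule config_fst_eq[OF conf that])
  have step: "d (p n x) (p (Suc n) x) \<le> 1 / 2 ^ n" "k < n \<Longrightarrow> i < n \<Longrightarrow> w (Suc n) k x i = w n k x i"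
    for n x k i
  proof -
    \<comment> \<open>Both halves of the next configuration come from \<open>S n\<close>, so
      whichever half bit \<open>n\<close> selects is close to \<open>c n\<close>.\<close>
    have "c (Suc n) \<in> double n (S n)" using S(2) c by blast
    then obtain a c1 c2 where g: "c (Suc n) = glue n a c1 c2" "c1 \<in> S n" "c2 \<in> S n"
      unfolding double_def by blast
    have cl: "close n (c n) c1" "close n (c n) c2"
      using S(1) c g(2,3) unfolding stage_def by blast+
    show "d (p n x) (p (Suc n) x) \<le> 1 / 2 ^ n"
      using cl by (simp add: p_def g(1) glue_def close_def)
    show "w (Suc n) k x i = w n k x i" if "k < n" "i < n"
      using cl that by (simp add: w_def g(1) glue_def close_def)
  qed
  \<comment> \<open>The bound is the exact partial sum of the geometric series, which makes the
    induction close.\<close>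
  have dist: "d (p n x) (p (n + m) x) \<le> 2 / 2 ^ n - 2 / 2 ^ (n + m)" for n m x
  proof (induction m)
    case 0
    then show ?case using pM by simp
  next
    case (Suc m)
    have "d (p n x) (p (n + Suc m) x) \<le> d (p n x) (p (n + m) x) + d (p (n + m) x) (p (Suc (n + m)) x)"
      using triangle[OF pM pM pM] by simp
    also have "\<dots> \<le> 2 / 2 ^ n - 2 / 2 ^ (n + m) + 1 / 2 ^ (n + m)"
      using Suc step(1)[of "n + m" x] by linarith
    also have "\<dots> = 2 / 2 ^ n - 2 / 2 ^ (n + Suc m)" by (simp add: field_simps)
    finally show ?case .
  qed
  have dist': "d (p n x) (p m x) \<le> 2 / 2 ^ n" if "n \<le> m" for n m x
    using dist[of n x "m - n"] that by (smt (verit) le_add_diff_inverse divide_nonneg_pos zero_less_power)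
  have "MCauchy (\<lambda>n. p n x)" for x
    unfolding MCauchy_def
  proof (intro conjI allI impI)
    show "range (\<lambda>n. p n x) \<subseteq> M" using pM by blast
    fix e :: real assume "e > 0"
    then obtain N where N: "2 / 2 ^ N < e / 2"
      using real_arch_pow_inv[of "e / 4" "1 / 2"] by (auto simp: field_simps)
    have "d (p n x) (p n' x) < e" if "N \<le> n" "N \<le> n'" for n n'
    proof -
      have "d (p n x) (p n' x) \<le> d (p N x) (p n x) + d (p N x) (p n' x)"
        by (rule triangle''[OF pM pM pM])
      then show ?thesis
        using dist'[OF that(1), of x] dist'[OF that(2), of x] N by linarith
    qed
    then show "\<exists>N. \<forall>n n'. N \<le> n \<longrightarrow> N \<le> n' \<longrightarrow> d (p n x) (p n' x) < e" by blast
  qed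
  then have "\<forall>x. \<exists>u. limitin mtopology (\<lambda>n. p n x) u sequentially"
    using complete unfolding mcomplete_def by blast
  then obtain \<phi> where \<phi>: "\<And>x. limitin mtopology (\<lambda>n. p n x) (\<phi> x) sequentially" by metis
  then have \<phi>M: "\<phi> x \<in> M" for x by (meson limitin_mspace)
  have lim: "d (p n x) (\<phi> x) \<le> 2 / 2 ^ n" for n x
  proof (rule field_le_epsilon)
    fix e :: real assume "e > 0"
    then obtain N where N: "\<And>m. m \<ge> N \<Longrightarrow> d (p m x) (\<phi> x) < e"
      using \<phi>[of x] unfolding limit_metric_sequentially by blast
    show "d (p n x) (\<phi> x) \<le> 2 / 2 ^ n + e"
      using triangle[OF pM[of n] pM[of "max n N"] \<phi>M, of x x x] dist'[of n "max n N" x]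
        N[of "max n N"] by simp
  qed
  have "d (\<phi> x) (\<phi> y) \<le> 4 / 2 ^ n" if "\<forall>i<n. x i = y i" for n x y
    using triangle''[OF \<phi>M[of x] pM[of n] \<phi>M[of y], of x] lim[of n x] lim[of n y] pdep[OF that]
    by (smt (verit) add_divide_distrib commute)
  moreover have "(\<phi> x, \<phi> (x(k := True))) \<notin> R" if "\<forall>i<k. x i = s k i" "\<not> x k" for k x
  proof -
    have w: "w (m + n) k x i = w n k x i" if "k < n" "i < n" for m n i
      using that by (induction m) (simp_all add: step(2))
    \<comment> \<open>Entry \<open>i\<close> of the witness for an edge of kind \<open>k\<close> no
      longer changes once the level exceeds both \<open>k\<close> and \<open>i\<close>.\<close>
    let ?w = "\<lambda>i. w (Suc (max k i)) k x i"
    have "(?w, \<phi> x, \<phi> (x(k := True))) \<in> C"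
    proof (rule seq_closedD[OF closedC])
      \<comment> \<open>The shift by \<open>Suc k\<close> is there because edges of kind
        \<open>k\<close> exist only from level \<open>Suc k\<close> on.\<close>
      show "(w (j + Suc k) k x, p (j + Suc k) x, p (j + Suc k) (x(k := True))) \<in> C" for j
        unfolding p_def w_def by (rule config_edge[OF conf _ that]) simp
      show "\<exists>N. \<forall>j\<ge>N. w (j + Suc k) k x i = ?w i" for i
      proof (intro exI allI impI)
        fix j assume "i \<le> j"
        then have "j + Suc k = (j + Suc k - Suc (max k i)) + Suc (max k i)" by simp
        then show "w (j + Suc k) k x i = ?w i"
          using w[of "Suc (max k i)" i "j + Suc k - Suc (max k i)"] by simp
      qed
      show "limitin (prod_topology mtopology mtopology)
          (\<lambda>j. (p (j + Suc k) x, p (j + Suc k) (x(k := True)))) (\<phi> x, \<phi> (x(k := True))) sequentially"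
        unfolding limitin_pairwise comp_def fst_conv snd_conv
        using limitin_sequentially_offset[OF \<phi>[of x], of "Suc k"]
          limitin_sequentially_offset[OF \<phi>[of "x(k := True)"], of "Suc k"] by blast
    qed
    then have "(\<phi> x, \<phi> (x(k := True))) \<in> M \<times> M - R"
      unfolding C using \<phi>M by blast
    then show ?thesis by blast
  qed
  ultimately show ?thesis using \<phi>M by blast
qed

end

section \<open>Baire category in the Cantor square\<close>

definition cyl :: "nat \<Rightarrow> (nat \<Rightarrow> 'b) \<Rightarrow> (nat \<Rightarrow> 'b) set" where
  "cyl n x = {y. \<forall>i<n. y i = x i}"

lemma cyl_self [simp]: "x \<in> cyl n x"
  by (simp add: cyl_def)

lemma cyl_mono: "n \<le> m \<Longrightarrow> y \<in> cyl n x \<Longrightarrow> cyl m y \<subseteq> cyl n x"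
  by (auto simp: cyl_def)

lemma openin_cyl: "openin cantor_topology (cyl n x)"
proof -
  have "finite {i. (if i < n then {x i} else UNIV) \<noteq> UNIV}"
    by (rule finite_subset[of _ "{..<n}"]) auto
  then have "openin cantor_topology (PiE UNIV (\<lambda>i. if i < n then {x i} else UNIV))"
    unfolding cantor_topology_def openin_PiE_gen by simp
  moreover have "PiE UNIV (\<lambda>i. if i < n then {x i} else UNIV) = cyl n x"
    by (auto simp: cyl_def PiE_iff split: if_splits)
  ultimately show ?thesis by simp
qed

lemma openin_cantor_iff: "openin cantor_topology U \<longleftrightarrow> (\<forall>x\<in>U. \<exists>n. cyl n x \<subseteq> U)"
proof
  assume U: "openin cantor_topology U"
  show "\<forall>x\<in>U. \<exists>n. cyl n x \<subseteq> U"
  proof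
    fix x assume "x \<in> U"
    then obtain V where fin: "finite {i. V i \<noteq> UNIV}" and V: "x \<in> PiE UNIV V" "PiE UNIV V \<subseteq> U"
      using U unfolding cantor_topology_def openin_product_topology_alt by auto
    obtain n where n: "{i. V i \<noteq> UNIV} \<subseteq> {..<n}"
      using finite_nat_bounded[OF fin] by blast
    have "y i \<in> V i" if "y \<in> cyl n x" for y i
    proof (cases "i < n")
      case True
      then have "y i = x i" using that by (simp add: cyl_def)
      then show ?thesis using V(1) by (simp add: PiE_iff)
    next
      case False
      then have "V i = UNIV" using n by auto
      then show ?thesis by simp
    qed
    then have "cyl n x \<subseteq> U" using V(2) by auto
    then show "\<exists>n. cyl n x \<subseteq> U" by (rule exI)
  qed
next
  assume "\<forall>x\<in>U. \<exists>n. cyl n x \<subseteq> U"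
  then show "openin cantor_topology U"
    unfolding openin_subopen[of cantor_topology U] using openin_cyl cyl_self by meson
qed

lemma topspace_cantor [simp]: "topspace cantor_topology = UNIV"
  by (simp add: cantor_topology_def)

abbreviation cantor_square :: "((nat \<Rightarrow> bool) \<times> (nat \<Rightarrow> bool)) topology" where
  "cantor_square \<equiv> prod_topology cantor_topology cantor_topology"

abbreviation rect :: "nat \<Rightarrow> (nat \<Rightarrow> bool) \<times> (nat \<Rightarrow> bool) \<Rightarrow> ((nat \<Rightarrow> bool) \<times> (nat \<Rightarrow> bool)) set" where
  "rect n p \<equiv> cyl n (fst p) \<times> cyl n (snd p)"

lemma rect_mono: "n \<le> m \<Longrightarrow> q \<in> rect n p \<Longrightarrow> rect m q \<subseteq> rect n p"
  using cyl_mono by (metis Sigma_mono mem_Times_iff)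

lemma rect_weaken: "v \<in> rect m p \<Longrightarrow> n \<le> m \<Longrightarrow> v \<in> rect n p"
  by (simp add: mem_Times_iff cyl_def)

lemma rect_self [simp]: "p \<in> rect n p"
  by (simp add: mem_Times_iff)

lemma openin_rect: "openin cantor_square (rect n p)"
  by (simp add: openin_prod_Times_iff openin_cyl)

lemma openin_square_iff: "openin cantor_square U \<longleftrightarrow> (\<forall>p\<in>U. \<exists>n. rect n p \<subseteq> U)"
proof
  assume U: "openin cantor_square U"
  show "\<forall>p\<in>U. \<exists>n. rect n p \<subseteq> U"
  proof
    fix p assume "p \<in> U"
    then obtain V W where VW: "openin cantor_topology V" "openin cantor_topology W"
      "fst p \<in> V" "snd p \<in> W" "V \<times> W \<subseteq> U"
      using U unfolding openin_prod_topology_alt by (metis prod.collapse)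
    then obtain m n where "cyl m (fst p) \<subseteq> V" "cyl n (snd p) \<subseteq> W"
      by (meson openin_cantor_iff)
    moreover have "cyl (max m n) (fst p) \<subseteq> cyl m (fst p)" "cyl (max m n) (snd p) \<subseteq> cyl n (snd p)"
      by (simp_all add: cyl_mono)
    ultimately have "rect (max m n) p \<subseteq> U" using VW(5) by blast
    then show "\<exists>n. rect n p \<subseteq> U" by (rule exI)
  qed
next
  assume "\<forall>p\<in>U. \<exists>n. rect n p \<subseteq> U"
  then show "openin cantor_square U"
    unfolding openin_subopen[of cantor_square U] using openin_rect rect_self by meson
qed

definition dense :: "((nat \<Rightarrow> bool) \<times> (nat \<Rightarrow> bool)) set \<Rightarrow> bool" where
  "dense D \<longleftrightarrow> (\<forall>n p. rect n p \<inter> D \<noteq> {})"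

lemma dense_iff_closure: "dense D \<longleftrightarrow> cantor_square closure_of D = UNIV"
proof
  assume D: "dense D"
  have "p \<in> cantor_square closure_of D" for p
    unfolding in_closure_of
  proof (intro conjI allI impI)
    fix T assume "p \<in> T \<and> openin cantor_square T"
    then obtain n where "rect n p \<subseteq> T" unfolding openin_square_iff by blast
    moreover obtain q where "q \<in> rect n p" "q \<in> D" using D unfolding dense_def by blast
    ultimately show "\<exists>y. y \<in> D \<and> y \<in> T" by blast
  qed simp
  then show "cantor_square closure_of D = UNIV" by blast
next
  assume D: "cantor_square closure_of D = UNIV"
  show "dense D"
    unfolding dense_def
  proof (intro allI)
    fix n p
    have "p \<in> cantor_square closure_of D" using D by simp
    then show "rect n p \<inter> D \<noteq> {}"
      unfolding in_closure_of using openin_rect[of n p] rect_self by blast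
  qed
qed

text \<open>The square is compact Hausdorff, hence locally compact and regular, so the Baire
  category theorem applies.\<close>

lemma baire_square:
  assumes "\<And>i::nat. openin cantor_square (D i)" "\<And>i. dense (D i)"
  shows "dense (\<Inter>i. D i)"
proof -
  have "compact_space cantor_square" "Hausdorff_space cantor_square"
    unfolding compact_space_prod_topology Hausdorff_space_prod_topology cantor_topology_def
    by (simp_all add: compact_space_product_topology Hausdorff_space_product_topology
        compact_space_discrete_topology)
  then have "locally_compact_space cantor_square \<and> regular_space cantor_square"
    by (simp add: compact_imp_locally_compact_space compact_Hausdorff_imp_regular_space)
  then have "cantor_square closure_of \<Inter>(range D) = topspace cantor_square"
    by (intro Baire_category) (use assms in \<open>auto simp: dense_iff_closure\<close>)
  then show ?thesis
    by (simp add: dense_iff_closure)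
qed

section \<open>Comeagerness in basic rectangles and the Baire property\<close>

text \<open>The witnessing sets are dense and open in the whole square, not merely in
  \<open>r\<close>, so witnesses belonging to different rectangles can be intersected.\<close>

definition comeager_in where
  "comeager_in r A \<longleftrightarrow> (\<exists>D. (\<forall>i::nat. openin cantor_square (D i) \<and> dense (D i)) \<and> r \<inter> (\<Inter>i. D i) \<subseteq> A)"

lemma comeager_in_mono: "comeager_in r A \<Longrightarrow> r' \<subseteq> r \<Longrightarrow> A \<subseteq> A' \<Longrightarrow> comeager_in r' A'"
  unfolding comeager_in_def by (meson Int_mono order_refl order_trans)

text \<open>Countably many sequences of dense open sets merge into one through
  \<open>prod_decode\<close>, and this one works for all \<open>j\<close> simultaneously.\<close>

lemma comeager_in_family:
  assumes "\<And>j::nat. comeager_in (r j) (A j)"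
  shows "\<exists>D. (\<forall>i::nat. openin cantor_square (D i) \<and> dense (D i)) \<and> (\<forall>j. r j \<inter> (\<Inter>i. D i) \<subseteq> A j)"
proof -
  have "\<forall>j. \<exists>D. (\<forall>i::nat. openin cantor_square (D i) \<and> dense (D i)) \<and> r j \<inter> (\<Inter>i. D i) \<subseteq> A j"
    using assms unfolding comeager_in_def by (rule allI)
  from choice[OF this] obtain D where
    D: "\<forall>j. (\<forall>i::nat. openin cantor_square (D j i) \<and> dense (D j i)) \<and> r j \<inter> (\<Inter>i. D j i) \<subseteq> A j"
    by (rule exE)
  define F where "F m = case_prod D (prod_decode m)" for m
  have "(\<Inter>m. F m) \<subseteq> (\<Inter>i. D j i)" for j
  proof (rule INT_greatest)
    fix i
    have "F (prod_encode (j, i)) = D j i" by (simp add: F_def)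
    then show "(\<Inter>m. F m) \<subseteq> D j i" by blast
  qed
  then have "r j \<inter> (\<Inter>m. F m) \<subseteq> A j" for j
    using D by (meson Int_mono order_refl order_trans)
  moreover have "openin cantor_square (F m) \<and> dense (F m)" for m
    using D by (simp add: F_def split: prod.split)
  ultimately show ?thesis by (intro exI[of _ F]) simp
qed

lemma comeager_in_INT:
  assumes "\<And>j::nat. comeager_in r (A j)"
  shows "comeager_in r (\<Inter>j. A j)"
proof -
  obtain D where "\<forall>i::nat. openin cantor_square (D i) \<and> dense (D i)" "\<forall>j. r \<inter> (\<Inter>i. D i) \<subseteq> A j"
    using comeager_in_family[of "\<lambda>_. r" A, OF assms] by (elim exE conjE)
  then show ?thesis
    unfolding comeager_in_def by (intro exI[of _ D] conjI INT_greatest) simp_all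
qed

text \<open>There are countably many basic rectangles, so one sequence \<open>D\<close> serves all
  those in which \<open>A\<close> is comeager. By \<open>loc\<close> their union is dense in the
  given rectangle and can be added to \<open>D\<close> as a further dense open set.\<close>

lemma comeager_in_local:
  assumes loc: "\<And>m q. rect m q \<subseteq> rect n p \<Longrightarrow> \<exists>k u. rect k u \<subseteq> rect m q \<and> comeager_in (rect k u) A"
  shows "comeager_in (rect n p) A"
proof -
  let ?\<R> = "{rect k u | k u. True}"
  \<comment> \<open>A rectangle is determined by its length and the positions of the true bits below
    that length, listed in \<open>a\<close> and \<open>b\<close>.\<close>
  have "?\<R> \<subseteq> (\<lambda>(k, a, b). rect k (\<lambda>i. i < k \<and> i \<in> set a, \<lambda>i. i < k \<and> i \<in> set b)) `
      (UNIV :: (nat \<times> nat list \<times> nat list) set)"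
  proof
    fix r assume "r \<in> ?\<R>"
    then obtain k u where r: "r = rect k u" by blast
    have eq: "cyl k x = cyl k (\<lambda>i. i < k \<and> i \<in> set (filter x [0..<k]))" for x
      by (auto simp: cyl_def)
    then have "r = (\<lambda>(k, a, b). rect k (\<lambda>i. i < k \<and> i \<in> set a, \<lambda>i. i < k \<and> i \<in> set b))
        (k, filter (fst u) [0..<k], filter (snd u) [0..<k])"
      unfolding r using eq[of "fst u"] eq[of "snd u"]
      by (simp only: prod.case fst_conv snd_conv)
    then show "r \<in> (\<lambda>(k, a, b). rect k (\<lambda>i. i < k \<and> i \<in> set a, \<lambda>i. i < k \<and> i \<in> set b)) `
      (UNIV :: (nat \<times> nat list \<times> nat list) set)" by (rule image_eqI) simp
  qed
  then have "countable ?\<R>"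
    by (rule countable_subset) simp
  define \<V> where "\<V> = {r \<in> ?\<R>. comeager_in r A}"
  have "countable \<V>"
    unfolding \<V>_def by (rule countable_subset[OF Collect_restrict \<open>countable ?\<R>\<close>])
  obtain k u where "comeager_in (rect k u) A"
    using loc[OF order_refl] by blast
  then have "rect k u \<in> \<V>" unfolding \<V>_def by blast
  then have "\<V> \<noteq> {}" by blast
  define V where "V = from_nat_into \<V>"
  have V: "range V = \<V>"
    unfolding V_def using \<open>countable \<V>\<close> \<open>\<V> \<noteq> {}\<close> by simp
  then have "comeager_in (V j) A" for j
    unfolding \<V>_def by blast
  from comeager_in_family[of V "\<lambda>_. A", OF this] obtain D
    where D: "\<forall>i::nat. openin cantor_square (D i) \<and> dense (D i)" "\<forall>j. V j \<inter> (\<Inter>i. D i) \<subseteq> A"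
    by (elim exE conjE)
  \<comment> \<open>The rectangles that miss \<open>rect n p\<close> make \<open>U\<close> dense in
    the whole square.\<close>
  define U where "U = \<Union>\<V> \<union> \<Union>{r \<in> ?\<R>. r \<inter> rect n p = {}}"
  have "openin cantor_square U"
    unfolding U_def \<V>_def by (intro openin_Un openin_Union) (auto simp: openin_prod_Times_iff openin_cyl)
  moreover have "dense U"
    unfolding dense_def
  proof (intro allI)
    fix m q
    show "rect m q \<inter> U \<noteq> {}"
    proof (cases "rect m q \<inter> rect n p = {}")
      case True
      then have "rect m q \<subseteq> U" unfolding U_def by blast
      then show ?thesis using rect_self by blast
    next
      case False
      then obtain v where "v \<in> rect m q" "v \<in> rect n p" by blast
      then have v: "rect (max m n) v \<subseteq> rect m q" "rect (max m n) v \<subseteq> rect n p"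
        using rect_mono[of m "max m n" v q] rect_mono[of n "max m n" v p] by simp_all
      obtain k u where "rect k u \<subseteq> rect (max m n) v" "comeager_in (rect k u) A"
        using loc[OF v(2)] by blast
      then have "rect k u \<subseteq> U" "rect k u \<subseteq> rect m q"
        using v(1) unfolding U_def \<V>_def by blast+
      then show ?thesis using rect_self by blast
    qed
  qed
  ultimately have E: "openin cantor_square (case_nat U D i) \<and> dense (case_nat U D i)" for i
    using D(1) by (simp split: nat.split)
  have "rect n p \<inter> (\<Inter>i. case_nat U D i) \<subseteq> A"
  proof
    fix z assume z: "z \<in> rect n p \<inter> (\<Inter>i. case_nat U D i)"
    have zi: "z \<in> case_nat U D i" for i using z by blast
    have "z \<in> U" using zi[of 0] by simp
    moreover have "z \<in> D i" for i using zi[of "Suc i"] by simp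
    moreover have "z \<in> rect n p" using z by blast
    ultimately obtain r where "r \<in> \<V>" "z \<in> r" unfolding U_def by blast
    moreover obtain j where "r = V j" using V \<open>r \<in> \<V>\<close> by blast
    ultimately show "z \<in> A" using D(2) \<open>\<And>i. z \<in> D i\<close> by blast
  qed
  with E show ?thesis
    unfolding comeager_in_def by (intro exI[of _ "case_nat U D"]) simp
qed

text \<open>Equivalent to the Baire property, and trivially closed under complements.\<close>

definition baire_property where
  "baire_property A \<longleftrightarrow> (\<forall>n p. \<exists>m q. rect m q \<subseteq> rect n p \<and>
    (comeager_in (rect m q) A \<or> comeager_in (rect m q) (- A)))"

lemma comeager_in_subset: "r \<subseteq> A \<Longrightarrow> comeager_in r A"
proof -
  assume "r \<subseteq> A"
  have "cyl n x \<noteq> {}" for n and x :: "nat \<Rightarrow> bool" using cyl_self by blast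
  then have "dense UNIV" by (simp add: dense_def)
  moreover have "openin cantor_square UNIV" using openin_topspace[of cantor_square] by simp
  ultimately show ?thesis
    using \<open>r \<subseteq> A\<close> unfolding comeager_in_def by (intro exI[of _ "\<lambda>_. UNIV"]) simp
qed

text \<open>In the union step, either some \<open>A j\<close> is comeager in a subrectangle, or
  every \<open>- A j\<close> is comeager in a subrectangle of each subrectangle. Then
  \<open>comeager_in_local\<close> makes each \<open>- A j\<close> comeager in the whole rectangle,
  and so is their intersection.\<close>

lemma baire_property_borel:
  assumes "A \<in> sets (borel_of cantor_square)"
  shows "baire_property A"
  using assms unfolding sets_borel_of
proof (induction rule: sigma_sets.induct)
  case (Basic A)
  show ?case
    unfolding baire_property_def
  proof (intro allI)
    fix n p
    show "\<exists>m q. rect m q \<subseteq> rect n p \<and> (comeager_in (rect m q) A \<or> comeager_in (rect m q) (- A))"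
    proof (cases "rect n p \<inter> A = {}")
      case True
      then have "comeager_in (rect n p) (- A)" by (intro comeager_in_subset) blast
      then show ?thesis by blast
    next
      case False
      then obtain q where q: "q \<in> rect n p" "q \<in> A" by blast
      have "openin cantor_square A" using Basic by simp
      then obtain m where "rect m q \<subseteq> A" using q(2) unfolding openin_square_iff by blast
      then have "rect (max m n) q \<subseteq> A" "rect (max m n) q \<subseteq> rect n p"
        using rect_mono[of m "max m n" q q] rect_mono[of n "max m n" q p] q(1) by auto
      then show ?thesis using comeager_in_subset by blast
    qed
  qed
next
  case Empty
  have "comeager_in (rect n p) (- {})" for n p by (rule comeager_in_subset) simp
  then show ?case unfolding baire_property_def by blast
next
  case (Compl A)
  then show ?case
    unfolding baire_property_def by (simp add: Compl_eq_Diff_UNIV double_diff) blast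
next
  case (Union A)
  show ?case
    unfolding baire_property_def
  proof (intro allI)
    fix n p
    show "\<exists>m q. rect m q \<subseteq> rect n p \<and>
      (comeager_in (rect m q) (\<Union>i. A i) \<or> comeager_in (rect m q) (- (\<Union>i. A i)))"
    proof (cases "\<exists>m q j. rect m q \<subseteq> rect n p \<and> comeager_in (rect m q) (A j)")
      case True
      then obtain m q j where "rect m q \<subseteq> rect n p" "comeager_in (rect m q) (A j)" by blast
      moreover from this(2) have "comeager_in (rect m q) (\<Union>i. A i)"
        by (rule comeager_in_mono) auto
      ultimately show ?thesis by blast
    next
      case False
      have "comeager_in (rect n p) (- A j)" for j
      proof (rule comeager_in_local)
        fix m q assume mq: "rect m q \<subseteq> rect n p"
        obtain k u where ku: "rect k u \<subseteq> rect m q"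
          "comeager_in (rect k u) (A j) \<or> comeager_in (rect k u) (- A j)"
          using Union.IH[of j] unfolding baire_property_def by blast
        moreover have "\<not> comeager_in (rect k u) (A j)"
          using False ku(1) mq by (meson order_trans)
        ultimately show "\<exists>k u. rect k u \<subseteq> rect m q \<and> comeager_in (rect k u) (- A j)" by blast
      qed
      then have "comeager_in (rect n p) (\<Inter>j. - A j)"
        by (rule comeager_in_INT)
      then have "comeager_in (rect n p) (- (\<Union>i. A i))" by simp
      then show ?thesis by blast
    qed
  qed
qed

text \<open>Suppose \<open>R\<close> is comeager in a rectangle. Flipping one bit \<open>k\<close>
  of the first coordinate is a homeomorphism, so a generic \<open>v\<close> and its flip both lie in
  \<open>R\<close>. They share the second coordinate, so symmetry and transitivity put the edge
  between their first coordinates into \<open>R\<close>.\<close>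

lemma comeager_complement_of_flip_free:
  fixes R :: "((nat \<Rightarrow> bool) \<times> (nat \<Rightarrow> bool)) set"
  assumes bp: "baire_property R" and "sym R" "trans R"
    and s: "\<And>n x. \<exists>k\<ge>n. \<forall>i<n. s k i = x i"
    and flip: "\<And>k x. \<forall>i<k. x i = s k i \<Longrightarrow> \<not> x k \<Longrightarrow> (x, x(k := True)) \<notin> R"
  shows "comeager_in UNIV (- R)"
proof -
  have no: "\<not> comeager_in (rect n p) R" for n p
  proof
    assume "comeager_in (rect n p) R"
    then obtain D where D: "\<forall>i::nat. openin cantor_square (D i) \<and> dense (D i)"
      "rect n p \<inter> (\<Inter>i. D i) \<subseteq> R"
      unfolding comeager_in_def by blast
    obtain k where k: "n \<le> k" "\<forall>i<n. s k i = fst p i" using s by blast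
    define F :: "(nat \<Rightarrow> bool) \<times> (nat \<Rightarrow> bool) \<Rightarrow> _"
      where "F q = ((fst q)(k := \<not> fst q k), snd q)" for q
    have FF: "F (F q) = q" for q by (simp add: F_def)
    have F_rect: "F v \<in> rect m (F q)" if "v \<in> rect m q" "k < m" for v m q
      using that by (auto simp: F_def cyl_def mem_Times_iff)
    \<comment> \<open>First coordinates of points of \<open>rect (Suc k) q\<close> follow
      \<open>s k\<close> and have bit \<open>k\<close> false: they are starting points of edges. As
      \<open>n \<le> k\<close>, the flip stays inside \<open>rect n p\<close>.\<close>
    define q where "q = ((s k)(k := False), snd p)"
    have "rect (Suc k) q \<subseteq> rect n p"
      by (rule rect_mono) (use k in \<open>auto simp: q_def cyl_def\<close>)
    have Fq: "F v \<in> rect n p" if "v \<in> rect (Suc k) q" for v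
      using that k by (auto simp: F_def q_def cyl_def mem_Times_iff)
    have "openin cantor_square (F -` D i)" for i
      unfolding openin_square_iff
    proof
      fix v assume "v \<in> F -` D i"
      then obtain m where m: "rect m (F v) \<subseteq> D i"
        using D(1) unfolding openin_square_iff by blast
      have "F u \<in> D i" if "u \<in> rect (max m (Suc k)) v" for u
      proof -
        have "F u \<in> rect (max m (Suc k)) (F v)"
          by (rule F_rect[OF that]) (simp add: less_max_iff_disj)
        then have "F u \<in> rect m (F v)" by (rule rect_weaken) simp
        then show ?thesis using m by (rule subsetD[rotated])
      qed
      then have "rect (max m (Suc k)) v \<subseteq> F -` D i" by (intro subsetI vimageI2)
      then show "\<exists>n. rect n v \<subseteq> F -` D i" by (rule exI)
    qed
    moreover have "dense (F -` D i)" for i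
      unfolding dense_def
    proof (intro allI)
      fix m v
      have "dense (D i)" using D(1) by simp
      then have "rect (max m (Suc k)) (F v) \<inter> D i \<noteq> {}"
        unfolding dense_def by (elim allE)
      then obtain u where u: "u \<in> rect (max m (Suc k)) (F v)" "u \<in> D i" by (meson disjoint_iff)
      then have "F u \<in> rect (max m (Suc k)) v"
        using F_rect[OF u(1)] by (simp add: FF less_max_iff_disj)
      then have "F u \<in> rect m v"
        by (rule rect_weaken) simp
      moreover have "F u \<in> F -` D i" using u(2) by (simp add: FF)
      ultimately show "rect m v \<inter> F -` D i \<noteq> {}" by (meson disjoint_iff)
    qed
    \<comment> \<open>The sets \<open>D i\<close> and their preimages are interleaved into a single
      sequence for \<open>baire_square\<close>.\<close>
    moreover define G where "G i = (if even i then D (i div 2) else F -` D (i div 2))" for i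
    ultimately have G: "openin cantor_square (G i)" "dense (G i)" for i
      using D(1) by simp_all
    have "dense (\<Inter>i. G i)"
      by (rule baire_square[OF G])
    then have "rect (Suc k) q \<inter> (\<Inter>i. G i) \<noteq> {}"
      unfolding dense_def by (elim allE)
    then obtain v where v: "v \<in> rect (Suc k) q" and "v \<in> (\<Inter>i. G i)"
      by (meson disjoint_iff)
    then have vi: "v \<in> G i" for i by blast
    have "v \<in> D i" "F v \<in> D i" for i
      using vi[of "2 * i"] vi[of "2 * i + 1"] by (simp_all add: G_def)
    then have "v \<in> (\<Inter>i. D i)" "F v \<in> (\<Inter>i. D i)" by (intro INT_I; simp)+
    then have "v \<in> R" "F v \<in> R"
      using subsetD[OF D(2)] subsetD[OF \<open>rect (Suc k) q \<subseteq> rect n p\<close> v] Fq[OF v]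
      by (simp_all only: Int_iff)
    then have "(fst v, fst (F v)) \<in> R"
      using \<open>sym R\<close> \<open>trans R\<close> by (metis F_def prod.collapse snd_conv symE transE)
    moreover have "\<forall>i<k. fst v i = s k i" "\<not> fst v k"
      using v by (auto simp: q_def cyl_def mem_Times_iff)
    ultimately show False
      using flip[of k "fst v"] by (simp add: F_def)
  qed
  \<comment> \<open>A cylinder of length \<open>0\<close> is the whole space, so the centre is
    arbitrary.\<close>
  have "comeager_in (rect 0 undefined) (- R)"
  proof (rule comeager_in_local)
    fix m q assume "rect m q \<subseteq> rect 0 undefined"
    show "\<exists>k u. rect k u \<subseteq> rect m q \<and> comeager_in (rect k u) (- R)"
      using bp no unfolding baire_property_def by blast
  qed
  moreover have "rect 0 undefined = UNIV" by (simp add: cyl_def)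
  ultimately show ?thesis by simp
qed

text \<open>One stage of the Mycielski fusion: finitely many tasks \<open>(a, b, i)\<close>, each asking that the
  rectangle given by the words \<open>a\<close> and \<open>b\<close> be contained in \<open>D i\<close>.\<close>

lemma mycielski_step:
  assumes D: "\<And>i::nat. openin cantor_square (D i)" "\<And>i. dense (D i)"
    and "finite J" "\<forall>(a, b, i)\<in>J. a \<noteq> b"
  shows "\<exists>q' L'. L \<le> L' \<and> (\<forall>a. q' a \<in> cyl L (q a)) \<and>
    (\<forall>(a, b, i)\<in>J. rect L' (q' a, q' b) \<subseteq> D i)"
  using assms(3,4)
proof (induction J rule: finite_induct)
  case empty
  show ?case by (intro exI[of _ q] exI[of _ L]) simp
next
  case (insert t J)
  obtain q' L' where q': "L \<le> L'" "\<forall>a. q' a \<in> cyl L (q a)"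
    "\<forall>(a, b, i)\<in>J. rect L' (q' a, q' b) \<subseteq> D i"
    using insert.IH insert.prems by auto
  obtain a b i where t: "t = (a, b, i)" by (cases t)
  then have "a \<noteq> b" using insert.prems by simp
  obtain v where v: "v \<in> rect L' (q' a, q' b)" "v \<in> D i"
    using D(2) unfolding dense_def by blast
  then obtain m where m: "rect m v \<subseteq> D i"
    using D(1) unfolding openin_square_iff by blast
  \<comment> \<open>Since \<open>a \<noteq> b\<close>, both updates take effect and the new task is
    met. Rectangles only shrink, so the earlier tasks stay met.\<close>
  define r where "r = q'(a := fst v, b := snd v)"
  have r: "r c \<in> cyl L' (q' c)" for c
    using v(1) by (auto simp: r_def)
  have rL: "r c \<in> cyl L (q c)" for c
    using r[of c] q'(2) cyl_mono[OF q'(1), of "q' c" "q c"] by blast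
  have task: "rect (max m L') (r c, r e) \<subseteq> D j" if "(c, e, j) \<in> insert t J" for c e j
  proof (cases "(c, e, j) \<in> J")
    case True
    have "rect (max m L') (r c, r e) \<subseteq> rect L' (q' c, q' e)"
      by (rule rect_mono) (simp_all add: r)
    then show ?thesis using True q'(3) by blast
  next
    case False
    then have "(r c, r e) = v" "j = i"
      using that t \<open>a \<noteq> b\<close> by (simp_all add: r_def)
    then show ?thesis
      using m rect_mono[of m "max m L'" v v] by auto
  qed
  have "\<forall>(c, e, j)\<in>insert t J. rect (max m L') (r c, r e) \<subseteq> D j"
    by (intro ballI) (metis (no_types, lifting) case_prodI2 task)
  moreover have "L \<le> max m L'" using q'(1) by simp
  ultimately show ?case
    by (intro exI[of _ r] exI[of _ "max m L'"] conjI allI rL)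
qed

text \<open>Words of length \<open>n\<close> are the truncations \<open>tr n x\<close>. Stage
  \<open>n\<close> assigns to each word a sequence and a common length, so that the rectangle of two
  distinct words lies in every \<open>D i\<close> with \<open>i < n\<close>; \<open>f x\<close> is
  the limit along the truncations of \<open>x\<close>.\<close>

lemma mycielski:
  assumes D: "\<And>i::nat. openin cantor_square (D i)" "\<And>i. dense (D i)"
  shows "\<exists>f :: (nat \<Rightarrow> bool) \<Rightarrow> nat \<Rightarrow> bool. (\<forall>n x y. (\<forall>i<n. x i = y i) \<longrightarrow> (\<forall>i<n. f x i = f y i)) \<and>
    (\<forall>x y. x \<noteq> y \<longrightarrow> (f x, f y) \<in> (\<Inter>i. D i))"
proof -
  define tr :: "nat \<Rightarrow> (nat \<Rightarrow> bool) \<Rightarrow> nat \<Rightarrow> bool" where "tr n x = (\<lambda>i. i < n \<and> x i)" for n x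
  define P where "P n s \<longleftrightarrow> n \<le> snd s \<and> (\<forall>a\<in>range (tr n). \<forall>b\<in>range (tr n). \<forall>i<n. a \<noteq> b \<longrightarrow>
    rect (snd s) (fst s a, fst s b) \<subseteq> D i)" for n and s :: "((nat \<Rightarrow> bool) \<Rightarrow> nat \<Rightarrow> bool) \<times> nat"
  define Q where "Q n s s' \<longleftrightarrow> snd s \<le> snd s' \<and> (\<forall>a. fst s' a \<in> cyl (snd s) (fst s (tr n a)))"
    for n and s s' :: "((nat \<Rightarrow> bool) \<Rightarrow> nat \<Rightarrow> bool) \<times> nat"
  have tr_range: "range (tr n) \<subseteq> {x. \<forall>i\<ge>n. \<not> x i}" for n
    by (auto simp: tr_def)
  have "\<exists>S. \<forall>n. P n (S n) \<and> Q n (S n) (S (Suc n))"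
  proof (rule dependent_nat_choice)
    show "\<exists>s. P 0 s" by (simp add: P_def)
  next
    fix s n assume s: "P n s"
    define W where "W = range (tr (Suc n))"
    define J where "J = {(a, b, i). a \<in> W \<and> b \<in> W \<and> i < Suc n \<and> a \<noteq> b}"
    have "finite W"
      unfolding W_def by (rule finite_subset[OF tr_range finite_zero_beyond])
    moreover have "J \<subseteq> W \<times> W \<times> {..<Suc n}" by (auto simp: J_def)
    ultimately have "finite J"
      by (meson finite_SigmaI finite_lessThan finite_subset)
    have "\<forall>(a, b, i)\<in>J. a \<noteq> b" by (auto simp: J_def)
    from mycielski_step[of D J "snd s" "\<lambda>a. fst s (tr n a)", OF D \<open>finite J\<close> this]
    obtain q L where q: "snd s \<le> L" "\<forall>a. q a \<in> cyl (snd s) (fst s (tr n a))"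
      "\<forall>(a, b, i)\<in>J. rect L (q a, q b) \<subseteq> D i"
      by (elim exE conjE)
    have "rect (max L (Suc n)) (q a, q b) \<subseteq> D i"
      if "a \<in> W" "b \<in> W" "i < Suc n" "a \<noteq> b" for a b i
    proof -
      have "(a, b, i) \<in> J" using that by (simp add: J_def)
      with q(3) have "rect L (q a, q b) \<subseteq> D i" by fastforce
      moreover have "rect (max L (Suc n)) (q a, q b) \<subseteq> rect L (q a, q b)"
        by (rule rect_mono) simp_all
      ultimately show ?thesis by (rule subset_trans[rotated])
    qed
    then have "P (Suc n) (q, max L (Suc n))"
      unfolding P_def W_def by simp
    moreover have "Q n s (q, max L (Suc n))"
      using q by (simp add: Q_def)
    ultimately show "\<exists>s'. P (Suc n) s' \<and> Q n s s'"
      by (intro exI[of _ "(q, max L (Suc n))"] conjI)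
  qed
  then obtain S where P: "\<And>n. P n (S n)" and Q: "\<And>n. Q n (S n) (S (Suc n))" by blast
  define g where "g n x = fst (S n) (tr n x)" for n x
  define L where "L n = snd (S n)" for n
  have L: "n \<le> L n" for n using P[of n] by (simp add: P_def L_def)
  have Lmono: "mono L"
    unfolding mono_iff_le_Suc using Q by (simp add: Q_def L_def)
  have tr_tr: "tr n (tr (Suc n) x) = tr n x" for n x by (auto simp: tr_def)
  have "fst (S (Suc n)) (tr (Suc n) x) \<in> cyl (L n) (fst (S n) (tr n (tr (Suc n) x)))" for n x
    using Q[of n] by (simp add: Q_def L_def)
  then have step: "g (Suc n) x \<in> cyl (L n) (g n x)" for n x
    by (simp add: g_def tr_tr)
  have stable: "g (n + m) x i = g n x i" if "i < L n" for n m x i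
  proof (induction m)
    case (Suc m)
    have "i < L (n + m)" using that monoD[OF Lmono, of n "n + m"] by simp
    then have "g (n + Suc m) x i = g (n + m) x i"
      using step[of "n + m" x] by (simp add: cyl_def)
    with Suc show ?case by simp
  qed simp
  \<comment> \<open>Stage \<open>Suc i\<close> already fixes coordinate \<open>i\<close>, because
    \<open>i < L (Suc i)\<close>.\<close>
  define f where "f x i = g (Suc i) x i" for x i
  have f: "f x i = g n x i" if "i < L n" for x i n
  proof -
    have "i < L (Suc i)" using L[of "Suc i"] by simp
    then show ?thesis
      unfolding f_def using stable[of i "Suc i" n x] stable[OF that, of "Suc i" x]
      by (simp add: add.commute)
  qed
  have 1: "f x i = f y i" if "\<forall>i<n. x i = y i" "i < n" for n x y i
  proof -
    have "tr n x = tr n y" using that(1) by (auto simp: tr_def)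
    then have "g n x = g n y" by (simp add: g_def)
    moreover have "i < L n" using that(2) L[of n] by simp
    ultimately show ?thesis by (simp add: f)
  qed
  have 2: "(f x, f y) \<in> D i" if "x \<noteq> y" for x y i
  proof -
    obtain j where j: "x j \<noteq> y j" using \<open>x \<noteq> y\<close> by blast
    \<comment> \<open>Late enough both to separate the truncations of \<open>x\<close> and
      \<open>y\<close> and to include the task for \<open>D i\<close>.\<close>
    let ?n = "Suc (max i j)"
    have "tr ?n x j \<noteq> tr ?n y j" using j by (simp add: tr_def less_Suc_eq_le)
    then have "tr ?n x \<noteq> tr ?n y" by metis
    then have "rect (L ?n) (g ?n x, g ?n y) \<subseteq> D i"
      using P[of ?n] unfolding P_def g_def L_def by simp
    moreover have "(f x, f y) \<in> rect (L ?n) (g ?n x, g ?n y)"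
      by (simp add: cyl_def f)
    ultimately show ?thesis by blast
  qed
  show ?thesis
    by (intro exI[of _ f] conjI allI impI INT_I 2) (rule 1, simp_all)
qed

section \<open>Silver's theorem\<close>

lemma continuous_map_borel_measurable:
  assumes "continuous_map X Y f"
  shows "f \<in> borel_of X \<rightarrow>\<^sub>M borel_of Y"
  unfolding borel_of_def[of Y]
proof (rule measurable_measure_of)
  show "{U. openin Y U} \<subseteq> Pow (topspace Y)" by (auto dest: openin_subset)
  show "f \<in> space (borel_of X) \<rightarrow> topspace Y"
    using assms by (auto simp: continuous_map_def)
  fix U assume "U \<in> {U. openin Y U}"
  then have "openin X {x \<in> topspace X. f x \<in> U}"
    using assms by (simp add: continuous_map_def)
  moreover have "f -` U \<inter> space (borel_of X) = {x \<in> topspace X. f x \<in> U}" by auto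
  ultimately show "f -` U \<inter> space (borel_of X) \<in> sets (borel_of X)"
    by (simp add: sets_borel_of sigma_sets.Basic)
qed

lemma (in Metric_space) continuous_map_cantor:
  fixes h :: "(nat \<Rightarrow> bool) \<Rightarrow> 'a"
  assumes "range h \<subseteq> M"
    and h: "\<And>n x y. \<forall>i<n. x i = y i \<Longrightarrow> d (h x) (h y) \<le> 4 / 2 ^ n"
  shows "continuous_map cantor_topology mtopology h"
  unfolding continuous_map_def
proof (intro conjI allI impI)
  show "h \<in> topspace cantor_topology \<rightarrow> topspace mtopology"
    using assms(1) by auto
  fix U assume U: "openin mtopology U"
  show "openin cantor_topology {x \<in> topspace cantor_topology. h x \<in> U}"
    unfolding openin_cantor_iff
  proof
    fix x assume "x \<in> {x \<in> topspace cantor_topology. h x \<in> U}"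
    then have "h x \<in> U" by simp
    then obtain r where r: "r > 0" "mball (h x) r \<subseteq> U"
      using U unfolding openin_mtopology by blast
    obtain n where n: "4 / 2 ^ n < r"
      using real_arch_pow_inv[of "r / 4" "1 / 2"] r(1) by (auto simp: field_simps)
    have "h y \<in> U" if "y \<in> cyl n x" for y
    proof -
      have "d (h x) (h y) \<le> 4 / 2 ^ n" using that by (intro h) (simp add: cyl_def)
      then have "h y \<in> mball (h x) r" using n assms(1) by auto
      then show ?thesis using r(2) by blast
    qed
    then have "cyl n x \<subseteq> {x \<in> topspace cantor_topology. h x \<in> U}" by auto
    then show "\<exists>n. cyl n x \<subseteq> {x \<in> topspace cantor_topology. h x \<in> U}" by (rule exI)
  qed
qed

theorem silver:
  fixes X :: "'a topology"
  assumes X: "Polish_topology X" and R: "equiv (topspace X) R"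
    and borel: "R \<in> sets (borel_of (prod_topology X X))"
    and uncountable: "uncountable (topspace X // R)"
  shows "\<exists>g :: (nat \<Rightarrow> bool) \<Rightarrow> 'a. continuous_map cantor_topology X g \<and> (\<forall>x y. x \<noteq> y \<longrightarrow> (g x, g y) \<notin> R)"
proof -
  obtain M d where M: "Metric_space M d" "Metric_space.mcomplete M d" "X = Metric_space.mtopology M d"
    using X unfolding Polish_topology_def completely_metrizable_space_def by blast
  interpret Metric_space M d by (fact M(1))
  have top: "topspace X = M" using M(3) by simp
  \<comment> \<open>The first component of \<open>k\<close> codes a word, padded with false bits.
    The second is free, so every word recurs at arbitrarily large \<open>k\<close>, which gives the
    density of the edges of \<open>G\<^sub>0\<close>.\<close>
  define s :: "nat \<Rightarrow> nat \<Rightarrow> bool"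
    where "s k i = (let l = from_nat (fst (prod_decode k)) in i < length l \<and> l ! i)" for k i
  have s: "\<exists>k\<ge>n. \<forall>i<n. s k i = x i" for n x
  proof (intro exI conjI allI impI)
    let ?k = "prod_encode (to_nat (map x [0..<n]), n)"
    show "n \<le> ?k" by (rule le_prod_encode_2)
    show "s ?k i = x i" if "i < n" for i
      using that by (simp add: s_def)
  qed
  have "metrizable_space X"
    using X unfolding Polish_topology_def by (simp add: completely_metrizable_imp_metrizable_space)
  then have "suslin (prod_topology X X) (topspace (prod_topology X X) - R)"
    using suslin_borel_of[OF _ borel] by (simp add: metrizable_space_prod_topology)
  then obtain C where C: "seq_closed (prod_topology X X) C"
    "M \<times> M - R = {w \<in> M \<times> M. \<exists>a. (a, w) \<in> C}"
    unfolding suslin_def by (auto simp: top)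
  interpret fusion M d R C s
  proof
    show mcomplete by (fact M(2))
    show "separable_space mtopology" using X M(3) by (simp add: Polish_topology_def)
    show "equiv M R" using R top by simp
    show "uncountable (M // R)" using uncountable top by simp
    show "seq_closed (prod_topology mtopology mtopology) C" using C(1) M(3) by simp
    show "M \<times> M - R = {w \<in> M \<times> M. \<exists>a. (a, w) \<in> C}" by (fact C(2))
  qed
  obtain \<phi> where \<phi>: "range \<phi> \<subseteq> M" "\<And>n x y. \<forall>i<n. x i = y i \<Longrightarrow> d (\<phi> x) (\<phi> y) \<le> 4 / 2 ^ n"
    "\<And>k x. \<forall>i<k. x i = s k i \<Longrightarrow> \<not> x k \<Longrightarrow> (\<phi> x, \<phi> (x(k := True))) \<notin> R"
    using homomorphism by (elim exE conjE) simp
  define S where "S = {p. (\<phi> (fst p), \<phi> (snd p)) \<in> R}"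
  have "continuous_map cantor_topology X \<phi>"
    using continuous_map_cantor[OF \<phi>(1,2)] M(3) by simp
  then have "continuous_map cantor_square (prod_topology X X) (\<lambda>p. (\<phi> (fst p), \<phi> (snd p)))"
    by (intro continuous_map_pairedI continuous_map_compose[OF continuous_map_fst, unfolded comp_def]
        continuous_map_compose[OF continuous_map_snd, unfolded comp_def])
  then have "(\<lambda>p. (\<phi> (fst p), \<phi> (snd p))) -` R \<inter> space (borel_of cantor_square)
      \<in> sets (borel_of cantor_square)"
    by (intro measurable_sets[OF continuous_map_borel_measurable borel])
  moreover have "(\<lambda>p. (\<phi> (fst p), \<phi> (snd p))) -` R \<inter> space (borel_of cantor_square) = S"
    by (auto simp: S_def)
  ultimately have "baire_property S"
    by (intro baire_property_borel) simp
  moreover have "sym S" "trans S"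
    using R by (auto simp: S_def equiv_def intro!: symI transI dest: symD transD)
  ultimately have "comeager_in UNIV (- S)"
    by (rule comeager_complement_of_flip_free[where s = s, OF _ _ _ s]) (use \<phi>(3) in \<open>simp add: S_def\<close>)
  then obtain D where D: "\<And>i::nat. openin cantor_square (D i)" "\<And>i. dense (D i)"
    "(\<Inter>i. D i) \<subseteq> - S"
    unfolding comeager_in_def by auto
  obtain f :: "(nat \<Rightarrow> bool) \<Rightarrow> nat \<Rightarrow> bool" where "\<forall>n x y. (\<forall>i<n. x i = y i) \<longrightarrow> (\<forall>i<n. f x i = f y i)"
    "\<forall>x y. x \<noteq> y \<longrightarrow> (f x, f y) \<in> (\<Inter>i. D i)"
    using mycielski[of D, OF D(1,2)] by (elim exE conjE)
  then have f: "\<And>n x y. \<forall>i<n. x i = y i \<Longrightarrow> \<forall>i<n. f x i = f y i"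
    "\<And>x y. x \<noteq> y \<Longrightarrow> (f x, f y) \<in> (\<Inter>i. D i)"
    by simp_all
  have inequiv: "(\<phi> (f x), \<phi> (f y)) \<notin> R" if "x \<noteq> y" for x y
    using subsetD[OF D(3) f(2)[OF that]] by (simp add: S_def)
  have "continuous_map cantor_topology mtopology (\<lambda>x. \<phi> (f x))"
    by (rule continuous_map_cantor) (use \<phi>(1,2) f(1) in auto)
  then have "continuous_map cantor_topology X (\<lambda>x. \<phi> (f x)) \<and>
      (\<forall>x y. x \<noteq> y \<longrightarrow> (\<phi> (f x), \<phi> (f y)) \<notin> R)"
    unfolding M(3) by (intro conjI allI impI inequiv)
  then show ?thesis
    by (rule exI[of _ "\<lambda>x. \<phi> (f x)"])
qed

section \<open>Tail equivalence relations\<close>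

text \<open>An open set is the union of the cylinders it contains, and there are only countably
  many, indexed by a length and a list of the true positions. Hence coordinates suffice.\<close>

lemma borel_measurable_cantor:
  fixes f :: "'b \<Rightarrow> nat \<Rightarrow> bool"
  assumes f: "\<And>j. {x \<in> space M. f x j} \<in> sets M"
  shows "f \<in> M \<rightarrow>\<^sub>M borel_of cantor_topology"
  unfolding borel_of_def
proof (rule measurable_measure_of)
  fix U :: "(nat \<Rightarrow> bool) set" assume "U \<in> {U. openin cantor_topology U}"
  then have U: "\<And>x. x \<in> U \<Longrightarrow> \<exists>n. cyl n x \<subseteq> U" by (simp add: openin_cantor_iff)
  define w :: "nat list \<Rightarrow> nat \<Rightarrow> bool" where "w a i \<longleftrightarrow> i \<in> set a" for a i
  define S where "S = {p. cyl (fst p) (w (snd p)) \<subseteq> U}"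
  have cyl_sets: "{x \<in> space M. f x \<in> cyl n b} \<in> sets M" for n b
  proof -
    have coord: "{x \<in> space M. f x i = b i} \<in> sets M" for i
    proof (cases "b i")
      case True
      then show ?thesis using f[of i] by simp
    next
      case False
      then show ?thesis using sets.sets_Collect_neg[OF f[of i]] by simp
    qed
    have "{x \<in> space M. f x \<in> cyl n b} = {x \<in> space M. \<forall>i\<in>{..<n}. f x i = b i}"
      by (simp add: cyl_def Ball_def)
    also have "\<dots> \<in> sets M"
      by (rule sets.sets_Collect_finite_All[OF coord finite_lessThan])
    finally show ?thesis .
  qed
  have "f -` U \<inter> space M = (\<Union>p\<in>S. {x \<in> space M. f x \<in> cyl (fst p) (w (snd p))})"
  proof (intro subset_antisym subsetI)
    fix x assume x: "x \<in> f -` U \<inter> space M"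
    then have "f x \<in> U" by simp
    from U[OF this] obtain n where n: "cyl n (f x) \<subseteq> U" by (rule exE)
    define a where "a = filter (f x) [0..<n]"
    have "cyl n (w a) = cyl n (f x)" by (auto simp: a_def w_def cyl_def)
    then show "x \<in> (\<Union>p\<in>S. {x \<in> space M. f x \<in> cyl (fst p) (w (snd p))})"
      using n x by (intro UN_I[of "(n, a)"]) (simp_all add: S_def)
  next
    fix x assume "x \<in> (\<Union>p\<in>S. {x \<in> space M. f x \<in> cyl (fst p) (w (snd p))})"
    then obtain p where "cyl (fst p) (w (snd p)) \<subseteq> U" "x \<in> space M" "f x \<in> cyl (fst p) (w (snd p))"
      by (auto simp: S_def)
    then show "x \<in> f -` U \<inter> space M" by (auto dest: subsetD)
  qed
  also have "\<dots> \<in> sets M"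
    by (rule sets.countable_UN''[OF countableI_type cyl_sets])
  finally show "f -` U \<inter> space M \<in> sets M" .
qed simp_all

text \<open>Row \<open>j\<close> of a binary matrix is sent by the Cantor set of inequivalent points
  into the \<open>j\<close>-th coordinate belonging to \<open>I\<close>. Related values then force
  equal rows, and equal rows are related by reflexivity.\<close>

lemma E1_reducible_tail:
  fixes X :: "nat \<Rightarrow> 'a topology" and g :: "nat \<Rightarrow> (nat \<Rightarrow> bool) \<Rightarrow> 'a"
  assumes nonempty: "\<And>n. topspace (X n) \<noteq> {}"
    and E: "\<And>x y. x \<in> (\<Pi>\<^sub>E n\<in>UNIV. topspace (X n)) \<Longrightarrow> y \<in> (\<Pi>\<^sub>E n\<in>UNIV. topspace (X n)) \<Longrightarrow>
      (x, y) \<in> E \<longleftrightarrow> (\<exists>m. \<forall>n\<ge>m. (x n, y n) \<in> R n)"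
    and refl: "\<And>n u. N \<le> n \<Longrightarrow> u \<in> topspace (X n) \<Longrightarrow> (u, u) \<in> R n"
    and I: "infinite I"
    and g: "\<And>n. n \<in> I \<Longrightarrow> continuous_map cantor_topology (X n) (g n)"
    and inj: "\<And>n x y. n \<in> I \<Longrightarrow> x \<noteq> y \<Longrightarrow> (g n x, g n y) \<notin> R n"
  shows "borel_reducible cantor_topology E1 (product_topology X UNIV) E"
proof -
  define r where "r = inv (enumerate I)"
  have e_mono: "strict_mono (enumerate I)" using I by (rule strict_mono_enumerate)
  have r: "r (enumerate I j) = j" for j
    unfolding r_def by (rule inv_f_f[OF strict_mono_imp_inj_on[OF e_mono]])
  \<comment> \<open>Outside \<open>I\<close> a fixed point is used, so these coordinates are related
    from \<open>N\<close> on.\<close>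
  define \<theta> where "\<theta> x n = (if n \<in> I then g n (\<lambda>k. x (r n, k)) else (SOME u. u \<in> topspace (X n)))"
    for x n
  have cont: "continuous_map cantor_topology (product_topology X UNIV) \<theta>"
    unfolding continuous_map_componentwise_UNIV
  proof
    fix n
    show "continuous_map cantor_topology (X n) (\<lambda>x. \<theta> x n)"
    proof (cases "n \<in> I")
      case True
      have "continuous_map cantor_topology cantor_topology (\<lambda>x k. x (r n, k))"
        unfolding cantor_topology_def continuous_map_componentwise_UNIV
        by (intro allI continuous_map_product_projection UNIV_I)
      then have "continuous_map cantor_topology (X n) (g n \<circ> (\<lambda>x k. x (r n, k)))"
        using g[OF True] by (rule continuous_map_compose)
      then show ?thesis using True by (simp add: \<theta>_def comp_def)
    next
      case False
      have "(SOME u. u \<in> topspace (X n)) \<in> topspace (X n)"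
        using nonempty by (simp add: some_in_eq)
      then show ?thesis using False by (simp add: \<theta>_def)
    qed
  qed
  then have in_top: "\<theta> x \<in> (\<Pi>\<^sub>E n\<in>UNIV. topspace (X n))" for x
    using continuous_map_image_subset_topspace[OF cont] by (auto simp: cantor_topology_def)
  have "(x, y) \<in> E1 \<longleftrightarrow> (\<theta> x, \<theta> y) \<in> E" for x y
    unfolding E[OF in_top in_top]
  proof
    assume "(x, y) \<in> E1"
    then obtain m where m: "\<And>j k. m \<le> j \<Longrightarrow> x (j, k) = y (j, k)"
      unfolding E1_def by blast
    have "(\<theta> x n, \<theta> y n) \<in> R n" if "max N (enumerate I m) \<le> n" for n
    proof -
      have "\<theta> x n = \<theta> y n"
      proof (cases "n \<in> I")
        case True
        then obtain j where j: "n = enumerate I j" using range_enumerate[OF I] by blast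
        then have "m \<le> j" using that strict_mono_less_eq[OF e_mono] by simp
        then show ?thesis using m by (simp add: \<theta>_def j r)
      qed (simp add: \<theta>_def)
      then show ?thesis using refl[of n "\<theta> y n"] that in_top[of y] by auto
    qed
    then show "\<exists>m. \<forall>n\<ge>m. (\<theta> x n, \<theta> y n) \<in> R n" by blast
  next
    assume "\<exists>m. \<forall>n\<ge>m. (\<theta> x n, \<theta> y n) \<in> R n"
    then obtain m where m: "\<And>n. m \<le> n \<Longrightarrow> (\<theta> x n, \<theta> y n) \<in> R n" by blast
    have "x (j, k) = y (j, k)" if "m \<le> j" for j k
    proof -
      \<comment> \<open>As \<open>j \<le> enumerate I j\<close>, the same bound \<open>m\<close>
        serves for rows and for coordinates.\<close>
      have "m \<le> enumerate I j" using that le_enumerate[OF I, of j] by simp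
      then have "(\<theta> x (enumerate I j), \<theta> y (enumerate I j)) \<in> R (enumerate I j)" by (rule m)
      moreover have "enumerate I j \<in> I" using I by (rule enumerate_in_set)
      ultimately have "(\<lambda>k. x (j, k)) = (\<lambda>k. y (j, k))"
        using inj[of "enumerate I j"] by (auto simp: \<theta>_def r)
      then show ?thesis by (rule fun_cong)
    qed
    then show "(x, y) \<in> E1" unfolding E1_def by blast
  qed
  then show ?thesis
    unfolding borel_reducible_def
    using continuous_map_borel_measurable[OF cont] by (intro bexI[of _ \<theta>]) simp_all
qed

text \<open>One-hot coding: bit \<open>(n, k)\<close> says that \<open>x n\<close> lies in the class
  numbered \<open>k\<close>. One coordinate changes at most two bits, so finitely many unrelated
  coordinates change finitely many bits. Conversely \<open>prod_encode (n, k) \<ge> n\<close>, so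
  agreement of late bits gives agreement of late classes.\<close>

lemma tail_reducible_E0:
  fixes X :: "nat \<Rightarrow> 'a topology"
  assumes E: "\<And>x y. x \<in> (\<Pi>\<^sub>E n\<in>UNIV. topspace (X n)) \<Longrightarrow> y \<in> (\<Pi>\<^sub>E n\<in>UNIV. topspace (X n)) \<Longrightarrow>
      (x, y) \<in> E \<longleftrightarrow> (\<exists>m. \<forall>n\<ge>m. (x n, y n) \<in> R n)"
    and equiv: "\<And>n. N \<le> n \<Longrightarrow> equiv (topspace (X n)) (R n)"
    and borel: "\<And>n. N \<le> n \<Longrightarrow> R n \<in> sets (borel_of (prod_topology (X n) (X n)))"
    and countable: "\<And>n. N \<le> n \<Longrightarrow> countable (topspace (X n) // R n)"
  shows "borel_reducible (product_topology X UNIV) E cantor_topology E0"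
proof -
  define c where "c n u = to_nat_on (topspace (X n) // R n) (R n `` {u})" for n u
  have c: "c n u = c n v \<longleftrightarrow> (u, v) \<in> R n"
    if "N \<le> n" "u \<in> topspace (X n)" "v \<in> topspace (X n)" for n u v
    unfolding c_def
    using that countable[OF that(1)] eq_equiv_class_iff[OF equiv[OF that(1)] that(2,3)]
    by (simp add: to_nat_on_inj quotientI)
  \<comment> \<open>A nonempty class is a section of the Borel set \<open>R n\<close>, that is, a
    preimage under a continuous map.\<close>
  have class_borel: "{u \<in> topspace (X n). c n u = k} \<in> sets (borel_of (X n))" if "N \<le> n" for n k
  proof (cases "\<exists>u\<in>topspace (X n). c n u = k")
    case True
    then obtain u where u: "u \<in> topspace (X n)" "c n u = k" by blast
    have "continuous_map (X n) (prod_topology (X n) (X n)) (\<lambda>v. (u, v))"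
      using u(1) by (intro continuous_map_pairedI) simp_all
    then have "(\<lambda>v. (u, v)) -` R n \<inter> space (borel_of (X n)) \<in> sets (borel_of (X n))"
      by (intro measurable_sets[OF continuous_map_borel_measurable borel[OF that]])
    moreover have "(\<lambda>v. (u, v)) -` R n \<inter> space (borel_of (X n)) = {u \<in> topspace (X n). c n u = k}"
    proof -
      have "c n v = k \<longleftrightarrow> (u, v) \<in> R n" if "v \<in> topspace (X n)" for v
        using c[OF \<open>N \<le> n\<close> u(1) that] u(2) by metis
      then show ?thesis by auto
    qed
    ultimately show ?thesis by simp
  next
    case False
    then have "{u \<in> topspace (X n). c n u = k} = {}" by blast
    then show ?thesis by (metis sets.empty_sets)
  qed
  define \<theta> where "\<theta> x j = (case prod_decode j of (n, k) \<Rightarrow> N \<le> n \<and> c n (x n) = k)" for x j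
  have \<theta>: "\<theta> x (prod_encode (n, k)) \<longleftrightarrow> N \<le> n \<and> c n (x n) = k" for x n k
    by (simp add: \<theta>_def)
  have "\<theta> \<in> borel_of (product_topology X UNIV) \<rightarrow>\<^sub>M borel_of cantor_topology"
  proof (rule borel_measurable_cantor)
    fix j
    obtain n k where j: "j = prod_encode (n, k)" by (metis prod.collapse prod_decode_inverse)
    show "{x \<in> space (borel_of (product_topology X UNIV)). \<theta> x j} \<in> sets (borel_of (product_topology X UNIV))"
    proof (cases "N \<le> n")
      case True
      have "continuous_map (product_topology X UNIV) (X n) (\<lambda>x. x n)"
        by (rule continuous_map_product_projection) simp
      then have "(\<lambda>x. x n) -` {u \<in> topspace (X n). c n u = k} \<inter> space (borel_of (product_topology X UNIV))
          \<in> sets (borel_of (product_topology X UNIV))"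
        by (intro measurable_sets[OF continuous_map_borel_measurable class_borel[OF True]])
      moreover have "(\<lambda>x. x n) -` {u \<in> topspace (X n). c n u = k} \<inter> space (borel_of (product_topology X UNIV))
          = {x \<in> space (borel_of (product_topology X UNIV)). \<theta> x j}"
        using True by (auto simp: j \<theta>)
      ultimately show ?thesis by simp
    next
      case False
      then show ?thesis by (simp add: j \<theta>)
    qed
  qed
  moreover have "(x, y) \<in> E \<longleftrightarrow> (\<theta> x, \<theta> y) \<in> E0"
    if x: "x \<in> (\<Pi>\<^sub>E n\<in>UNIV. topspace (X n))" and y: "y \<in> (\<Pi>\<^sub>E n\<in>UNIV. topspace (X n))" for x y
    unfolding E[OF x y]
  proof
    have c': "c n (x n) = c n (y n) \<longleftrightarrow> (x n, y n) \<in> R n" if "N \<le> n" for n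
      using c[OF that, of "x n" "y n"] x y by auto
    {
      assume "\<exists>m. \<forall>n\<ge>m. (x n, y n) \<in> R n"
      then obtain m where m: "\<And>n. m \<le> n \<Longrightarrow> (x n, y n) \<in> R n" by blast
      let ?D = "{j. \<theta> x j \<noteq> \<theta> y j}"
      have "?D \<subseteq> prod_encode ` (SIGMA n:{..<m}. {c n (x n), c n (y n)})"
      proof
        fix j assume j: "j \<in> ?D"
        obtain n k where nk: "j = prod_encode (n, k)" by (metis prod.collapse prod_decode_inverse)
        have "n < m"
        proof (rule ccontr)
          assume "\<not> n < m"
          then have "N \<le> n \<Longrightarrow> c n (x n) = c n (y n)" using m c' by simp
          then show False using j by (auto simp: nk \<theta>)
        qed
        then show "j \<in> prod_encode ` (SIGMA n:{..<m}. {c n (x n), c n (y n)})"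
          using j by (auto simp: nk \<theta>)
      qed
      then have "finite ?D" by (rule finite_subset) simp
      then obtain J where "?D \<subseteq> {..<J}" using finite_nat_bounded by blast
      then have "\<forall>j\<ge>J. \<theta> x j = \<theta> y j" by auto
      then show "(\<theta> x, \<theta> y) \<in> E0" by (auto simp: E0_def)
    }
    {
      assume "(\<theta> x, \<theta> y) \<in> E0"
      then obtain J where J: "\<And>j. J \<le> j \<Longrightarrow> \<theta> x j = \<theta> y j" unfolding E0_def by blast
      have "(x n, y n) \<in> R n" if "max N J \<le> n" for n
      proof -
        have "J \<le> prod_encode (n, c n (x n))"
          using that le_prod_encode_1[of n "c n (x n)"] by simp
        from J[OF this] have "c n (y n) = c n (x n)" using that by (simp add: \<theta>)
        moreover have "N \<le> n" using that by simp
        ultimately show ?thesis using c' by metis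
      qed
      then show "\<exists>m. \<forall>n\<ge>m. (x n, y n) \<in> R n" by blast
    }
  qed
  ultimately show ?thesis
    unfolding borel_reducible_def by (intro bexI[of _ \<theta>]) simp_all
qed

text \<open>If some coordinate relation violated an axiom at infinitely many \<open>n\<close>, then \<open>E\<close> would violate it.\<close>

lemma tail_equiv:
  fixes X :: "nat \<Rightarrow> 'a set"
  assumes nonempty: "\<And>n. X n \<noteq> {}"
    and equiv: "equiv (\<Pi>\<^sub>E n\<in>UNIV. X n) E"
    and E: "\<And>x y. x \<in> (\<Pi>\<^sub>E n\<in>UNIV. X n) \<Longrightarrow> y \<in> (\<Pi>\<^sub>E n\<in>UNIV. X n) \<Longrightarrow>
      (x, y) \<in> E \<longleftrightarrow> (\<exists>m. \<forall>n\<ge>m. (x n, y n) \<in> R n)"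
    and R: "\<And>n. R n \<subseteq> X n \<times> X n"
  shows "\<exists>N. \<forall>n\<ge>N. equiv (X n) (R n)"
proof -
  obtain p where p: "\<And>n. p n \<in> X n" using nonempty by (meson ex_in_conv)
  \<comment> \<open>The chosen point violates reflexivity wherever that is possible, so a single
    sequence tests all coordinates at once.\<close>
  have "\<forall>n. \<exists>u. u \<in> X n \<and> ((u, u) \<in> R n \<longrightarrow> (\<forall>u\<in>X n. (u, u) \<in> R n))"
    using p by blast
  from choice[OF this] obtain x where x: "\<And>n. x n \<in> X n"
    "\<And>n. (x n, x n) \<in> R n \<Longrightarrow> \<forall>u\<in>X n. (u, u) \<in> R n" by blast
  have "x \<in> (\<Pi>\<^sub>E n\<in>UNIV. X n)" using x(1) by (simp add: PiE_iff)
  then have "\<exists>m. \<forall>n\<ge>m. (x n, x n) \<in> R n"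
    using E equiv by (metis equiv_def refl_onD)
  then obtain N0 where N0: "\<And>n u. N0 \<le> n \<Longrightarrow> u \<in> X n \<Longrightarrow> (u, u) \<in> R n"
    using x(2) by meson
  \<comment> \<open>A pair violating symmetry if there is one, and otherwise a diagonal pair, which
    lies in \<open>R n\<close> from \<open>N0\<close> on; the two resulting sequences are therefore
    related by \<open>E\<close>.\<close>
  have "\<forall>n. \<exists>q. fst q \<in> X n \<and> snd q \<in> X n \<and> (N0 \<le> n \<longrightarrow> q \<in> R n) \<and>
    ((snd q, fst q) \<in> R n \<longrightarrow> sym (R n))"
  proof
    fix n
    show "\<exists>q. fst q \<in> X n \<and> snd q \<in> X n \<and> (N0 \<le> n \<longrightarrow> q \<in> R n) \<and> ((snd q, fst q) \<in> R n \<longrightarrow> sym (R n))"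
    proof (cases "sym (R n)")
      case True
      then show ?thesis using p N0 by (intro exI[of _ "(p n, p n)"]) simp
    next
      case False
      then obtain u v where "(u, v) \<in> R n" "(v, u) \<notin> R n" unfolding sym_def by blast
      then show ?thesis using R[of n] by (intro exI[of _ "(u, v)"]) auto
    qed
  qed
  from choice[OF this] obtain q where q: "\<And>n. fst (q n) \<in> X n" "\<And>n. snd (q n) \<in> X n"
    "\<And>n. N0 \<le> n \<Longrightarrow> q n \<in> R n" "\<And>n. (snd (q n), fst (q n)) \<in> R n \<Longrightarrow> sym (R n)" by blast
  have in_prod: "(\<lambda>n. fst (q n)) \<in> (\<Pi>\<^sub>E n\<in>UNIV. X n)" "(\<lambda>n. snd (q n)) \<in> (\<Pi>\<^sub>E n\<in>UNIV. X n)"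
    using q by (simp_all add: PiE_iff)
  have "(\<lambda>n. fst (q n), \<lambda>n. snd (q n)) \<in> E"
    unfolding E[OF in_prod] using q(3) by (intro exI[of _ N0]) simp
  then have "(\<lambda>n. snd (q n), \<lambda>n. fst (q n)) \<in> E"
    using equiv by (meson equiv_def symE)
  then obtain N1 where N1: "\<And>n. N1 \<le> n \<Longrightarrow> sym (R n)"
    unfolding E[OF in_prod(2,1)] using q(4) by blast
  \<comment> \<open>The same device with triples, for transitivity.\<close>
  have "\<forall>n. \<exists>t. fst t \<in> X n \<and> fst (snd t) \<in> X n \<and> snd (snd t) \<in> X n \<and>
    (N0 \<le> n \<longrightarrow> (fst t, fst (snd t)) \<in> R n \<and> snd t \<in> R n) \<and>
    ((fst t, snd (snd t)) \<in> R n \<longrightarrow> trans (R n))"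
  proof
    fix n
    show "\<exists>t. fst t \<in> X n \<and> fst (snd t) \<in> X n \<and> snd (snd t) \<in> X n \<and>
      (N0 \<le> n \<longrightarrow> (fst t, fst (snd t)) \<in> R n \<and> snd t \<in> R n) \<and>
      ((fst t, snd (snd t)) \<in> R n \<longrightarrow> trans (R n))"
    proof (cases "trans (R n)")
      case True
      then show ?thesis using p N0 by (intro exI[of _ "(p n, p n, p n)"]) simp
    next
      case False
      then obtain u v w where "(u, v) \<in> R n" "(v, w) \<in> R n" "(u, w) \<notin> R n"
        unfolding trans_def by blast
      then show ?thesis using R[of n] by (intro exI[of _ "(u, v, w)"]) auto
    qed
  qed
  from choice[OF this] obtain t where t: "\<And>n. fst (t n) \<in> X n" "\<And>n. fst (snd (t n)) \<in> X n"
    "\<And>n. snd (snd (t n)) \<in> X n"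
    "\<And>n. N0 \<le> n \<Longrightarrow> (fst (t n), fst (snd (t n))) \<in> R n" "\<And>n. N0 \<le> n \<Longrightarrow> snd (t n) \<in> R n"
    "\<And>n. (fst (t n), snd (snd (t n))) \<in> R n \<Longrightarrow> trans (R n)" by blast
  have in_prod: "(\<lambda>n. fst (t n)) \<in> (\<Pi>\<^sub>E n\<in>UNIV. X n)" "(\<lambda>n. fst (snd (t n))) \<in> (\<Pi>\<^sub>E n\<in>UNIV. X n)"
    "(\<lambda>n. snd (snd (t n))) \<in> (\<Pi>\<^sub>E n\<in>UNIV. X n)"
    using t by (simp_all add: PiE_iff)
  have "(\<lambda>n. fst (t n), \<lambda>n. fst (snd (t n))) \<in> E"
    unfolding E[OF in_prod(1,2)] using t(4) by (intro exI[of _ N0]) simp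
  moreover have "(\<lambda>n. fst (snd (t n)), \<lambda>n. snd (snd (t n))) \<in> E"
    unfolding E[OF in_prod(2,3)] using t(5) by (intro exI[of _ N0]) simp
  ultimately have "(\<lambda>n. fst (t n), \<lambda>n. snd (snd (t n))) \<in> E"
    using equiv by (meson equiv_def transE)
  then obtain N2 where N2: "\<And>n. N2 \<le> n \<Longrightarrow> trans (R n)"
    unfolding E[OF in_prod(1,3)] using t(6) by blast
  have "equiv (X n) (R n)" if "max N0 (max N1 N2) \<le> n" for n
    using that R N0 N1 N2 by (intro equivI refl_onI) auto
  then show ?thesis by blast
qed

section \<open>Thresholds and weighted sums\<close>

lemma summable_mask:
  fixes f :: "nat \<Rightarrow> real"
  assumes "summable f" "\<And>m. 0 \<le> f m"
  shows "summable (\<lambda>m. if P m then f m else 0)"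
  by (rule summable_comparison_test'[OF assms(1), of 0]) (use assms(2) in simp)

lemma summable_add_iff_nonneg:
  fixes f g :: "nat \<Rightarrow> real"
  assumes "\<And>m. 0 \<le> f m" "\<And>m. 0 \<le> g m"
  shows "summable (\<lambda>m. f m + g m) \<longleftrightarrow> summable f \<and> summable g"
proof
  assume sum: "summable (\<lambda>m. f m + g m)"
  have "norm (f m) \<le> f m + g m" "norm (g m) \<le> f m + g m" for m
    using assms[of m] by simp_all
  then show "summable f \<and> summable g"
    using summable_comparison_test'[OF sum, of 0 f] summable_comparison_test'[OF sum, of 0 g] by simp
qed (simp add: summable_add)

lemma summable_else_iff:
  fixes f g :: "nat \<Rightarrow> real"
  assumes "summable g" "\<And>m. 0 \<le> g m" "\<And>m. 0 \<le> f m"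
  shows "summable (\<lambda>m. if P m then f m else g m) \<longleftrightarrow> summable (\<lambda>m. if P m then f m else 0)"
proof -
  have "(\<lambda>m. if P m then f m else g m) = (\<lambda>m. (if P m then f m else 0) + (if \<not> P m then g m else 0))"
    by auto
  then show ?thesis
    using assms summable_mask[of g "\<lambda>m. \<not> P m"] by (simp add: summable_add_iff_nonneg)
qed

text \<open>The least end point at which the block sum reaches \<open>e\<close> overshoots by at
  most its last term, which is at most \<open>e\<close>.\<close>

lemma nonsummable_block:
  fixes a :: "nat \<Rightarrow> real"
  assumes "\<not> summable a" "\<And>n. 0 \<le> a n" "\<And>n. a n \<le> e" "0 < e"
  shows "\<exists>M>N. e \<le> sum a {N..<M} \<and> sum a {N..<M} \<le> 2 * e"
proof -
  have "\<exists>M. e \<le> sum a {N..<M}"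
  proof (rule ccontr)
    assume "\<not> ?thesis"
    then have le: "sum a {N..<M} \<le> e" for M by (simp add: not_le less_imp_le)
    have "sum a {..<M} \<le> sum a {..<N} + e" for M
    proof -
      have "sum a {..<M} \<le> sum a ({..<N} \<union> {N..<M})"
        using assms(2) by (intro sum_mono2) auto
      also have "\<dots> = sum a {..<N} + sum a {N..<M}"
        by (rule sum.union_disjoint) auto
      finally show ?thesis using le[of M] by simp
    qed
    then have "summable a" by (rule summableI_nonneg_bounded[OF assms(2)])
    with assms(1) show False by simp
  qed
  then have least: "e \<le> sum a {N..<LEAST M. e \<le> sum a {N..<M}}" by (rule LeastI_ex)
  define M where "M = (LEAST M. e \<le> sum a {N..<M})"
  have "N < M"
  proof (rule ccontr)
    assume "\<not> N < M"
    then have "sum a {N..<M} = 0" by simp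
    then show False using least \<open>0 < e\<close> unfolding M_def by simp
  qed
  then obtain L where L: "M = Suc L" "N \<le> L" by (cases M) auto
  then have "\<not> e \<le> sum a {N..<L}"
    unfolding M_def by (metis lessI not_less_Least)
  then have "sum a {N..<M} \<le> 2 * e"
    using assms(3)[of L] L by simp
  then show ?thesis
    using \<open>N < M\<close> least unfolding M_def by blast
qed

lemma strict_mono_interval:
  fixes N :: "nat \<Rightarrow> nat"
  assumes "strict_mono N" "N 0 = 0"
  shows "\<exists>!j. N j \<le> m \<and> m < N (Suc j)"
proof -
  have "m < N (Suc m)"
    using strict_mono_imp_increasing[OF assms(1), of "Suc m"] by simp
  then have 1: "m < N (Suc (LEAST j. m < N (Suc j)))" by (rule LeastI)
  have 2: "N (LEAST j. m < N (Suc j)) \<le> m"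
  proof (cases "LEAST j. m < N (Suc j)")
    case 0
    then show ?thesis using assms(2) by simp
  next
    case (Suc i)
    then show ?thesis using not_less_Least[of i "\<lambda>j. m < N (Suc j)"] by simp
  qed
  have "i = j" if "N i \<le> m" "m < N (Suc i)" "N j \<le> m" "m < N (Suc j)" for i j
  proof -
    have "N i < N (Suc j)" "N j < N (Suc i)" using that by simp_all
    then show ?thesis using strict_mono_less[OF assms(1)] by simp
  qed
  with 1 2 show ?thesis by blast
qed

lemma summable_blocks_iff:
  fixes f :: "nat \<Rightarrow> real" and N :: "nat \<Rightarrow> nat"
  assumes f: "\<And>m. 0 \<le> f m" and N: "strict_mono N" "N 0 = 0"
  shows "summable f \<longleftrightarrow> summable (\<lambda>j. sum f {N j..<N (Suc j)})"
proof -
  have blocks: "sum f {..<N J} = (\<Sum>j<J. sum f {N j..<N (Suc j)})" for J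
  proof (induction J)
    case (Suc J)
    have "N J \<le> N (Suc J)" using strict_mono_less_eq[OF N(1)] by simp
    then have "sum f {..<N (Suc J)} = sum f {..<N J} + sum f {N J..<N (Suc J)}"
      unfolding lessThan_atLeast0 by (simp add: sum.atLeastLessThan_concat)
    with Suc show ?case by simp
  qed (simp add: N(2))
  have block_nonneg: "0 \<le> sum f {N j..<N (Suc j)}" for j
    using f by (simp add: sum_nonneg)
  show ?thesis
  proof
    assume sum: "summable f"
    show "summable (\<lambda>j. sum f {N j..<N (Suc j)})"
    proof (rule summableI_nonneg_bounded)
      fix J
      show "(\<Sum>j<J. sum f {N j..<N (Suc j)}) \<le> suminf f"
        unfolding blocks[symmetric] using f by (intro sum_le_suminf[OF sum]) simp_all
    qed (rule block_nonneg)
  next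
    assume sum: "summable (\<lambda>j. sum f {N j..<N (Suc j)})"
    show "summable f"
    proof (rule summableI_nonneg_bounded)
      fix J
      have "J \<le> N J" by (rule strict_mono_imp_increasing[OF N(1)])
      then have "sum f {..<J} \<le> sum f {..<N J}"
        using f by (intro sum_mono2) auto
      also have "\<dots> \<le> (\<Sum>j. sum f {N j..<N (Suc j)})"
        unfolding blocks using block_nonneg by (intro sum_le_suminf[OF sum]) simp_all
      finally show "sum f {..<J} \<le> (\<Sum>j. sum f {N j..<N (Suc j)})" .
    qed (rule f)
  qed
qed

text \<open>\<open>K\<close> indexes the multiples of \<open>e\<close> in a half-open interval
  between \<open>x\<close> and \<open>y\<close>. Their number is a difference of two ceilings, so
  rounding changes it by at most \<open>1\<close>, that is, by \<open>e\<close> after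
  scaling.\<close>

lemma card_grid_between:
  fixes x y e :: real
  assumes "0 < e"
  defines "K \<equiv> {i. (real_of_int (int_decode i) * e < x) \<noteq> (real_of_int (int_decode i) * e < y)}"
  shows "finite K" "\<bar>e * card K - \<bar>x - y\<bar>\<bar> \<le> e"
proof -
  have main: "finite L \<and> \<bar>e * card L - \<bar>a - b\<bar>\<bar> \<le> e"
    if "a \<le> b" and L: "L = {i. a \<le> real_of_int (int_decode i) * e \<and> real_of_int (int_decode i) * e < b}"
    for a b and L :: "nat set"
  proof -
    have "L = int_decode -` {\<lceil>a / e\<rceil>..<\<lceil>b / e\<rceil>}"
      using assms(1) by (auto simp: L ceiling_le_iff less_ceiling_iff field_simps)
    moreover have "bij int_decode" by (rule bij_int_decode)
    ultimately have L': "finite L" "card L = nat (\<lceil>b / e\<rceil> - \<lceil>a / e\<rceil>)"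
      by (simp_all add: finite_vimageI bij_is_inj card_vimage_inj bij_is_surj)
    have "\<lceil>a / e\<rceil> \<le> \<lceil>b / e\<rceil>"
      using that(1) assms(1) by (intro ceiling_mono divide_right_mono) simp_all
    then have "real (card L) = real_of_int \<lceil>b / e\<rceil> - real_of_int \<lceil>a / e\<rceil>"
      using L'(2) by simp
    then have "\<bar>real (card L) - (b / e - a / e)\<bar> \<le> 1"
      by linarith
    then have "e * \<bar>real (card L) - (b / e - a / e)\<bar> \<le> e * 1"
      using assms(1) by (intro mult_left_mono) simp_all
    moreover have "e * \<bar>real (card L) - (b / e - a / e)\<bar> = \<bar>e * (real (card L) - (b / e - a / e))\<bar>"
      using assms(1) by (simp add: abs_mult)
    moreover have "e * (real (card L) - (b / e - a / e)) = e * card L - (b - a)"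
      using assms(1) by (simp add: field_simps)
    ultimately show ?thesis using L'(1) that(1) by simp
  qed
  have "finite K \<and> \<bar>e * card K - \<bar>x - y\<bar>\<bar> \<le> e"
  proof (cases "x \<le> y")
    case True
    then show ?thesis by (intro main) (auto simp: K_def)
  next
    case False
    then have "finite K \<and> \<bar>e * card K - \<bar>y - x\<bar>\<bar> \<le> e"
      by (intro main) (auto simp: K_def)
    then show ?thesis by (simp add: abs_minus_commute)
  qed
  then show "finite K" "\<bar>e * card K - \<bar>x - y\<bar>\<bar> \<le> e" by simp_all
qed

text \<open>At \<open>n\<close> two codes differ in \<open>2 ^ n * \<bar>x n - y n\<bar>\<close> bits up to an error of at most \<open>1\<close>, so that
  weighting the bits by the mesh recovers the distance modulo a summable error.\<close>

definition mesh :: "nat \<Rightarrow> real" where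
  "mesh j = 1 / 2 ^ fst (prod_decode j)"

definition threshold_code :: "(nat \<Rightarrow> real) \<Rightarrow> nat \<Rightarrow> bool" where
  "threshold_code x j \<longleftrightarrow> of_int (int_decode (snd (prod_decode j))) * mesh j < x (fst (prod_decode j))"

lemma mesh_pos: "0 < mesh j"
  by (simp add: mesh_def)

lemma threshold_code_summable_iff:
  "summable (\<lambda>j. if threshold_code x j \<noteq> threshold_code y j then mesh j else 0) \<longleftrightarrow>
    summable (\<lambda>n. \<bar>x n - y n\<bar>)"
proof -
  define f where "f j = (if threshold_code x j \<noteq> threshold_code y j then mesh j else 0)" for j
  define e :: "nat \<Rightarrow> real" where "e n = 1 / 2 ^ n" for n
  define K where "K n = {i. (real_of_int (int_decode i) * e n < x n) \<noteq> (real_of_int (int_decode i) * e n < y n)}"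
    for n
  have e: "0 < e n" for n by (simp add: e_def)
  have K: "finite (K n)" "\<bar>e n * card (K n) - \<bar>x n - y n\<bar>\<bar> \<le> e n" for n
    unfolding K_def by (rule card_grid_between[OF e])+
  have f_nonneg: "0 \<le> f j" for j using mesh_pos[of j] by (simp add: f_def)
  have f: "f (prod_encode (n, i)) = (if i \<in> K n then e n else 0)" for n i
    by (simp add: f_def K_def threshold_code_def mesh_def e_def)
  \<comment> \<open>Finite sets that collect the differing bits row by row. A nonzero term with
    index \<open>j < J\<close> lies in \<open>G J\<close>, since the row number is at most
    \<open>j\<close>.\<close>
  define G where "G n = prod_encode ` (SIGMA n:{..<n}. K n)" for n
  have G: "sum f (G J) = (\<Sum>n<J. e n * card (K n))" for J
  proof -
    have "sum f (G J) = (\<Sum>(n, i)\<in>(SIGMA n:{..<J}. K n). f (prod_encode (n, i)))"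
      unfolding G_def by (subst sum.reindex) (auto simp: inj_prod_encode split_def)
    also have "\<dots> = (\<Sum>n<J. \<Sum>i\<in>K n. f (prod_encode (n, i)))"
      using K(1) by (intro sum.Sigma[symmetric]) simp_all
    also have "\<dots> = (\<Sum>n<J. e n * card (K n))"
      by (simp add: f mult.commute)
    finally show ?thesis .
  qed
  have G_finite: "finite (G J)" for J
    unfolding G_def using K(1) by simp
  have eK: "0 \<le> e n * card (K n)" for n using e[of n] by simp
  have "summable f \<longleftrightarrow> summable (\<lambda>n. e n * card (K n))"
  proof
    assume sum: "summable f"
    show "summable (\<lambda>n. e n * card (K n))"
    proof (rule summableI_nonneg_bounded[OF eK])
      show "(\<Sum>n<J. e n * card (K n)) \<le> suminf f" for J
        unfolding G[symmetric] using f_nonneg G_finite by (intro sum_le_suminf[OF sum]) simp_all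
    qed
  next
    assume sum: "summable (\<lambda>n. e n * card (K n))"
    show "summable f"
    proof (rule summableI_nonneg_bounded[OF f_nonneg])
      fix J
      have "f j = 0" if "j < J" "j \<notin> G J" for j
      proof -
        obtain n i where j: "j = prod_encode (n, i)" by (metis prod.collapse prod_decode_inverse)
        then have "n < J" using that(1) le_prod_encode_1[of n i] by simp
        then have "i \<notin> K n" using that(2) by (auto simp: G_def j)
        then show ?thesis by (simp add: j f)
      qed
      then have "sum f {..<J} = sum f ({..<J} \<inter> G J)"
        by (intro sum.mono_neutral_right) auto
      also have "\<dots> \<le> sum f (G J)"
        using f_nonneg G_finite by (intro sum_mono2) auto
      also have "\<dots> \<le> (\<Sum>n. e n * card (K n))"
        unfolding G using eK by (intro sum_le_suminf[OF sum]) simp_all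
      finally show "sum f {..<J} \<le> (\<Sum>n. e n * card (K n))" .
    qed
  qed
  also have "\<dots> \<longleftrightarrow> summable (\<lambda>n. \<bar>x n - y n\<bar>)"
  proof -
    have "summable e" unfolding e_def using summable_geometric[of "1 / 2 :: real"] by (simp add: power_one_over)
    \<comment> \<open>The rounding errors are dominated by the geometric series
      \<open>e\<close>.\<close>
    have diff: "summable (\<lambda>n. e n * card (K n) - \<bar>x n - y n\<bar>)"
      by (rule summable_comparison_test'[OF \<open>summable e\<close>, of 0]) (use K(2) in simp)
    show ?thesis
      using summable_diff[OF _ diff, of "\<lambda>n. e n * card (K n)"]
        summable_add[OF _ diff, of "\<lambda>n. \<bar>x n - y n\<bar>"] by auto
  qed
  finally show ?thesis unfolding f_def .
qed

section \<open>The case of divergent small weights\<close>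

text \<open>Consecutive blocks of coordinates carry the bits of the threshold code, block
  \<open>j\<close> with total weight comparable to \<open>mesh j\<close>;
  \<open>threshold_code_summable_iff\<close> then turns the sum over differing bits into the
  distance in \<open>ell1\<close>.\<close>

lemma ell1_reducible:
  fixes X :: "nat \<Rightarrow> 'a topology" and \<psi> :: "nat \<Rightarrow> 'a \<times> 'a \<Rightarrow> real"
  defines "T \<equiv> (\<Pi>\<^sub>E n\<in>UNIV. topspace (X n))"
  assumes nonneg: "\<And>n u v. u \<in> topspace (X n) \<Longrightarrow> v \<in> topspace (X n) \<Longrightarrow> 0 \<le> \<psi> n (u, v)"
    and E_iff: "\<And>x y. x \<in> T \<Longrightarrow> y \<in> T \<Longrightarrow> (x, y) \<in> E \<longleftrightarrow> summable (\<lambda>n. \<psi> n (x n, y n))"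
    and equiv: "equiv T E"
    and div: "\<And>\<delta>. 0 < \<delta> \<Longrightarrow> \<exists>x\<in>T. \<exists>y\<in>T.
      \<not> summable (\<lambda>n. if \<psi> n (x n, y n) \<le> \<delta> then \<psi> n (x n, y n) else 0)"
  shows "borel_reducible real_seq_topology real_seq_mod_ell1 (product_topology X UNIV) E"
proof -
  define tr where "tr \<delta> n p = (if \<psi> n p \<le> \<delta> then \<psi> n p else 0)" for \<delta> n p
  have T: "x n \<in> topspace (X n)" if "x \<in> T" for x n
    using that by (auto simp: T_def)
  define good where "good j a b p \<longleftrightarrow> fst p \<in> T \<and> snd p \<in> T \<and>
      mesh j \<le> (\<Sum>n=a..<b. tr (mesh j) n (fst p n, snd p n)) \<and>
      (\<Sum>n=a..<b. tr (mesh j) n (fst p n, snd p n)) \<le> 2 * mesh j" for j a b p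
  \<comment> \<open>The threshold for block \<open>j\<close> is \<open>mesh j\<close> itself, so no
    single term exceeds it and \<open>nonsummable_block\<close> applies. The pair of sequences may
    change from block to block.\<close>
  have "\<exists>N. \<forall>j. (j = 0 \<longrightarrow> N j = 0) \<and> (N j < N (Suc j) \<and> (\<exists>p. good j (N j) (N (Suc j)) p))"
  proof (rule dependent_nat_choice)
    fix N j :: nat
    obtain x y where xy: "x \<in> T" "y \<in> T" "\<not> summable (\<lambda>n. tr (mesh j) n (x n, y n))"
      using div[OF mesh_pos[of j]] unfolding tr_def by blast
    have "0 \<le> tr (mesh j) n (x n, y n)" "tr (mesh j) n (x n, y n) \<le> mesh j" for n
      using nonneg[OF T[OF xy(1)] T[OF xy(2)], of n] mesh_pos[of j] by (simp_all add: tr_def)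
    from nonsummable_block[OF xy(3) this mesh_pos, of N] obtain M where M: "N < M"
      "mesh j \<le> (\<Sum>n=N..<M. tr (mesh j) n (x n, y n))"
      "(\<Sum>n=N..<M. tr (mesh j) n (x n, y n)) \<le> 2 * mesh j" by blast
    then have "good j N M (x, y)" using xy(1,2) by (simp add: good_def)
    then show "\<exists>M. (Suc j = 0 \<longrightarrow> M = 0) \<and> (N < M \<and> (\<exists>p. good j N M p))"
      using M(1) by blast
  qed simp
  then obtain N where N_all: "\<forall>j. (j = 0 \<longrightarrow> N j = 0) \<and> (N j < N (Suc j) \<and> (\<exists>p. good j (N j) (N (Suc j)) p))"
    by (rule exE)
  then have N0: "N 0 = 0" and N_less: "\<And>j. N j < N (Suc j)"
    and "\<forall>j. \<exists>p. good j (N j) (N (Suc j)) p"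
    by simp_all
  from choice[OF this(3)] obtain p where "\<forall>j. good j (N j) (N (Suc j)) (p j)"
    by (rule exE)
  then have p: "\<And>j. fst (p j) \<in> T" "\<And>j. snd (p j) \<in> T"
    "\<And>j. mesh j \<le> (\<Sum>n=N j..<N (Suc j). tr (mesh j) n (fst (p j) n, snd (p j) n))"
    "\<And>j. (\<Sum>n=N j..<N (Suc j). tr (mesh j) n (fst (p j) n, snd (p j) n)) \<le> 2 * mesh j"
    by (simp_all add: good_def)
  have N: "strict_mono N" using N_less by (simp add: strict_mono_Suc_iff)
  define blk where "blk m = (THE j. N j \<le> m \<and> m < N (Suc j))" for m
  have blk: "blk m = j" if "N j \<le> m" "m < N (Suc j)" for m j
    unfolding blk_def by (rule the1_equality[OF strict_mono_interval[OF N N0]]) (simp add: that)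
  define u where "u m = fst (p (blk m)) m" for m
  \<comment> \<open>Where the weight exceeds the threshold, \<open>v\<close> repeats
    \<open>u\<close>. Only a diagonal term remains there, and diagonal terms are summable because
    \<open>E\<close> is reflexive.\<close>
  define v where "v m = (if \<psi> m (u m, snd (p (blk m)) m) \<le> mesh (blk m) then snd (p (blk m)) m else u m)" for m
  define W where "W m = tr (mesh (blk m)) m (u m, snd (p (blk m)) m)" for m
  have u_in: "u m \<in> topspace (X m)" for m unfolding u_def by (rule T[OF p(1)])
  have v_in: "v m \<in> topspace (X m)" for m unfolding v_def using u_in T[OF p(2)] by simp
  have W_nonneg: "0 \<le> W m" for m
    using nonneg[OF u_in T[OF p(2)]] by (simp add: W_def tr_def)
  have W_block: "mesh j \<le> sum W {N j..<N (Suc j)}" "sum W {N j..<N (Suc j)} \<le> 2 * mesh j" for j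
  proof -
    have "sum W {N j..<N (Suc j)} = (\<Sum>n=N j..<N (Suc j). tr (mesh j) n (fst (p j) n, snd (p j) n))"
      by (intro sum.cong) (simp_all add: W_def u_def blk[of j])
    then show "mesh j \<le> sum W {N j..<N (Suc j)}" "sum W {N j..<N (Suc j)} \<le> 2 * mesh j"
      using p(3,4)[of j] by simp_all
  qed
  define mix where "mix P m = (if P m then v m else u m)" for P :: "nat \<Rightarrow> bool" and m
  have mix_in: "mix P \<in> T" for P
    using u_in v_in by (simp add: T_def PiE_iff mix_def)
  have diag: "summable (\<lambda>m. \<psi> m (x m, x m))" if "x \<in> T" for x
    using equiv that E_iff[OF that that] by (metis equiv_def refl_onD)
  have diag_nonneg: "0 \<le> \<psi> m (x m, x m)" if "x \<in> T" for x m
    using nonneg T[OF that] by simp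
  have uv: "0 \<le> \<psi> m (u m, v m)" and vu: "0 \<le> \<psi> m (v m, u m)" for m
    using nonneg u_in v_in by simp_all
  have u_T: "u \<in> T" using u_in by (simp add: T_def PiE_iff)
  \<comment> \<open>Although \<open>\<psi>\<close> itself may be asymmetric, symmetry of
    \<open>E\<close> between \<open>u\<close> and \<open>mix P\<close> allows the arguments to be
    exchanged as far as summability is concerned.\<close>
  have flip: "summable (\<lambda>m. if P m then \<psi> m (u m, v m) else 0) \<longleftrightarrow>
      summable (\<lambda>m. if P m then \<psi> m (v m, u m) else 0)" for P
  proof -
    have "summable (\<lambda>m. if P m then \<psi> m (u m, v m) else 0) \<longleftrightarrow>
        summable (\<lambda>m. if P m then \<psi> m (u m, v m) else \<psi> m (u m, u m))"
      by (rule summable_else_iff[OF diag[OF u_T] diag_nonneg[OF u_T] uv, symmetric])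
    also have "\<dots> \<longleftrightarrow> (u, mix P) \<in> E"
      unfolding E_iff[OF u_T mix_in] by (intro arg_cong[where f = summable]) (auto simp: mix_def)
    also have "\<dots> \<longleftrightarrow> (mix P, u) \<in> E"
      using equiv by (meson equiv_def symE)
    also have "\<dots> \<longleftrightarrow> summable (\<lambda>m. if P m then \<psi> m (v m, u m) else \<psi> m (u m, u m))"
      unfolding E_iff[OF mix_in u_T] by (intro arg_cong[where f = summable]) (auto simp: mix_def)
    also have "\<dots> \<longleftrightarrow> summable (\<lambda>m. if P m then \<psi> m (v m, u m) else 0)"
      by (rule summable_else_iff[OF diag[OF u_T] diag_nonneg[OF u_T] vu])
    finally show ?thesis .
  qed
  have W: "summable (\<lambda>m. if P m then \<psi> m (u m, v m) else 0) \<longleftrightarrow> summable (\<lambda>m. if P m then W m else 0)" for P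
  proof -
    define Q where "Q m \<longleftrightarrow> \<psi> m (u m, snd (p (blk m)) m) \<le> mesh (blk m)" for m
    have "(\<lambda>m. if P m then \<psi> m (u m, v m) else 0) =
        (\<lambda>m. (if P m then W m else 0) + (if P m \<and> \<not> Q m then \<psi> m (u m, u m) else 0))"
      by (auto simp: W_def tr_def v_def Q_def)
    moreover have "summable (\<lambda>m. if P m \<and> \<not> Q m then \<psi> m (u m, u m) else 0)"
      by (rule summable_mask[OF diag[OF u_T] diag_nonneg[OF u_T]])
    ultimately show ?thesis
      using W_nonneg diag_nonneg[OF u_T] by (simp add: summable_add_iff_nonneg)
  qed
  \<comment> \<open>Where \<open>P\<close> and \<open>Q\<close> agree only summable diagonal terms
    occur. Where they differ, \<open>flip\<close> orients all terms from \<open>u\<close> to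
    \<open>v\<close>, and \<open>W\<close> replaces them by the truncated weights.\<close>
  have mix_E: "(mix P, mix Q) \<in> E \<longleftrightarrow> summable (\<lambda>m. if P m \<noteq> Q m then W m else 0)" for P Q
  proof -
    let ?f = "\<lambda>m. if \<not> P m \<and> Q m then \<psi> m (u m, v m) else 0"
    let ?g = "\<lambda>m. if P m \<and> \<not> Q m then \<psi> m (v m, u m) else 0"
    let ?g' = "\<lambda>m. if P m \<and> \<not> Q m then \<psi> m (u m, v m) else 0"
    have "(mix P, mix Q) \<in> E \<longleftrightarrow>
        summable (\<lambda>m. if P m \<noteq> Q m then \<psi> m (mix P m, mix Q m) else \<psi> m (mix P m, mix P m))"
      unfolding E_iff[OF mix_in mix_in] by (intro arg_cong[where f = summable]) (auto simp: mix_def)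
    also have "\<dots> \<longleftrightarrow> summable (\<lambda>m. if P m \<noteq> Q m then \<psi> m (mix P m, mix Q m) else 0)"
      using nonneg[OF T[OF mix_in] T[OF mix_in]]
      by (intro summable_else_iff diag diag_nonneg mix_in)
    also have "(\<lambda>m. if P m \<noteq> Q m then \<psi> m (mix P m, mix Q m) else 0) = (\<lambda>m. ?f m + ?g m)"
      by (auto simp: mix_def)
    also have "summable \<dots> \<longleftrightarrow> summable ?f \<and> summable ?g"
      using uv vu by (intro summable_add_iff_nonneg) simp_all
    also have "\<dots> \<longleftrightarrow> summable ?f \<and> summable ?g'"
      by (simp only: flip)
    also have "\<dots> \<longleftrightarrow> summable (\<lambda>m. ?f m + ?g' m)"
      using uv by (intro summable_add_iff_nonneg[symmetric]) simp_all
    also have "(\<lambda>m. ?f m + ?g' m) = (\<lambda>m. if P m \<noteq> Q m then \<psi> m (u m, v m) else 0)"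
      by auto
    finally show ?thesis by (simp only: W)
  qed
  have blocks: "summable (\<lambda>m. if a (blk m) \<noteq> b (blk m) then W m else 0) \<longleftrightarrow>
      summable (\<lambda>j. if a j \<noteq> b j then mesh j else 0)" for a b :: "nat \<Rightarrow> bool"
  proof -
    let ?W = "\<lambda>j. sum W {N j..<N (Suc j)}"
    have "summable (\<lambda>m. if a (blk m) \<noteq> b (blk m) then W m else 0) \<longleftrightarrow>
        summable (\<lambda>j. \<Sum>m=N j..<N (Suc j). if a (blk m) \<noteq> b (blk m) then W m else 0)"
      using W_nonneg by (intro summable_blocks_iff N N0) simp
    also have "(\<lambda>j. \<Sum>m=N j..<N (Suc j). if a (blk m) \<noteq> b (blk m) then W m else 0) =
        (\<lambda>j. if a j \<noteq> b j then ?W j else 0)"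
    proof
      fix j
      have "(\<Sum>m=N j..<N (Suc j). if a (blk m) \<noteq> b (blk m) then W m else 0) =
          (\<Sum>m=N j..<N (Suc j). if a j \<noteq> b j then W m else 0)"
        by (intro sum.cong) (simp_all add: blk[of j])
      then show "(\<Sum>m=N j..<N (Suc j). if a (blk m) \<noteq> b (blk m) then W m else 0) =
          (if a j \<noteq> b j then ?W j else 0)" by simp
    qed
    also have "summable \<dots> \<longleftrightarrow> summable (\<lambda>j. if a j \<noteq> b j then mesh j else 0)"
    proof
      assume "summable (\<lambda>j. if a j \<noteq> b j then ?W j else 0)"
      then show "summable (\<lambda>j. if a j \<noteq> b j then mesh j else 0)"
        by (rule summable_comparison_test'[where N = 0])
          (use W_block(1) mesh_pos in \<open>simp add: less_imp_le\<close>)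
    next
      assume "summable (\<lambda>j. if a j \<noteq> b j then mesh j else 0)"
      then have "summable (\<lambda>j. 2 * (if a j \<noteq> b j then mesh j else 0))"
        by (rule summable_mult)
      then show "summable (\<lambda>j. if a j \<noteq> b j then ?W j else 0)"
        by (rule summable_comparison_test'[where N = 0])
          (use W_block(2) W_nonneg in \<open>simp add: sum_nonneg\<close>)
    qed
    finally show ?thesis .
  qed
  define \<theta> where "\<theta> x = mix (\<lambda>m. threshold_code x (blk m))" for x
  have "(x, y) \<in> real_seq_mod_ell1 \<longleftrightarrow> (\<theta> x, \<theta> y) \<in> E" for x y
    unfolding \<theta>_def mix_E
    by (simp only: blocks threshold_code_summable_iff real_seq_mod_ell1_def ell1_def mem_Collect_eq prod.case)
  moreover have "\<theta> \<in> borel_of real_seq_topology \<rightarrow>\<^sub>M borel_of (product_topology X UNIV)"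
  proof -
    have code: "threshold_code \<in> borel_of real_seq_topology \<rightarrow>\<^sub>M borel_of cantor_topology"
    proof (rule borel_measurable_cantor)
      fix j
      let ?n = "fst (prod_decode j)" and ?c = "of_int (int_decode (snd (prod_decode j))) * mesh j"
      have "continuous_map real_seq_topology euclidean (\<lambda>x. x ?n)"
        unfolding real_seq_topology_def by (rule continuous_map_product_projection) simp
      then have "openin real_seq_topology {x \<in> topspace real_seq_topology. x ?n \<in> {?c<..}}"
        by (rule openin_continuous_map_preimage) simp
      then show "{x \<in> space (borel_of real_seq_topology). threshold_code x j} \<in> sets (borel_of real_seq_topology)"
        by (simp add: threshold_code_def sets_borel_of sigma_sets.Basic)
    qed
    have cont: "continuous_map cantor_topology (product_topology X UNIV) (\<lambda>a. mix (\<lambda>m. a (blk m)))"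
      unfolding continuous_map_componentwise_UNIV
    proof
      fix m
      have "continuous_map cantor_topology (discrete_topology UNIV) (\<lambda>a. a (blk m))"
        unfolding cantor_topology_def by (rule continuous_map_product_projection) simp
      moreover have "continuous_map (discrete_topology UNIV) (X m) (\<lambda>b. if b then v m else u m)"
        using u_in v_in by simp
      ultimately have "continuous_map cantor_topology (X m) ((\<lambda>b. if b then v m else u m) \<circ> (\<lambda>a. a (blk m)))"
        by (rule continuous_map_compose)
      then show "continuous_map cantor_topology (X m) (\<lambda>a. mix (\<lambda>m. a (blk m)) m)"
        by (simp add: mix_def comp_def)
    qed
    show ?thesis
      using measurable_compose[OF code continuous_map_borel_measurable[OF cont]]
      by (simp add: \<theta>_def[abs_def])
  qed
  ultimately show ?thesis
    unfolding borel_reducible_def by (intro bexI[of _ \<theta>]) simp_all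
qed

section \<open>The trichotomy\<close>

theorem theorem1p4:
  fixes X :: "nat \<Rightarrow> 'a topology"
    and \<psi> :: "nat \<Rightarrow> 'a \<times> 'a \<Rightarrow> real"
    and E :: "((nat \<Rightarrow> 'a) \<times> (nat \<Rightarrow> 'a)) set"
  assumes nonempty: "\<And>n. topspace (X n) \<noteq> {}"
    and Polish: "\<And>n. Polish_topology (X n)"
    and borel: "\<And>n. \<psi> n \<in> borel_measurable (borel_of (prod_topology (X n) (X n)))"
    and nonneg: "\<And>n u v. u \<in> topspace (X n) \<Longrightarrow> v \<in> topspace (X n) \<Longrightarrow> 0 \<le> \<psi> n (u, v)"
    and E_def: "E = sum_rel (\<lambda>n. topspace (X n)) \<psi>"
    and equiv: "equiv (\<Pi>\<^sub>E n\<in>UNIV. topspace (X n)) E"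
  shows "borel_reducible real_seq_topology real_seq_mod_ell1 (product_topology X UNIV) E
    \<or> borel_reducible cantor_topology E1 (product_topology X UNIV) E
    \<or> borel_reducible (product_topology X UNIV) E cantor_topology E0"
proof -
  let ?T = "\<Pi>\<^sub>E n\<in>UNIV. topspace (X n)"
  have E_iff: "(x, y) \<in> E \<longleftrightarrow> summable (\<lambda>n. \<psi> n (x n, y n))" if "x \<in> ?T" "y \<in> ?T" for x y
    using that by (simp add: E_def sum_rel_def)
  define P where "P \<delta> \<longleftrightarrow> (\<forall>x\<in>?T. \<forall>y\<in>?T.
    summable (\<lambda>n. if \<psi> n (x n, y n) \<le> \<delta> then \<psi> n (x n, y n) else 0))" for \<delta>
  show ?thesis
  proof (cases "\<exists>\<delta>>0. P \<delta>")
    case False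
    have div: "\<exists>x\<in>?T. \<exists>y\<in>?T. \<not> summable (\<lambda>n. if \<psi> n (x n, y n) \<le> \<delta> then \<psi> n (x n, y n) else 0)"
      if "0 < \<delta>" for \<delta>
    proof -
      have "\<not> P \<delta>" using False that by blast
      then show ?thesis unfolding P_def by (simp only: ball_simps bex_simps not_not simp_thms)
    qed
    show ?thesis
      by (rule disjI1, rule ell1_reducible[OF nonneg E_iff equiv div])
  next
    case True
    then obtain \<delta> where "\<delta> > 0" "P \<delta>" by blast
    then have \<delta>: "\<delta> > 0" "\<And>x y. x \<in> ?T \<Longrightarrow> y \<in> ?T \<Longrightarrow>
      summable (\<lambda>n. if \<psi> n (x n, y n) \<le> \<delta> then \<psi> n (x n, y n) else 0)"
      unfolding P_def by (simp_all only:)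
    define R where "R n = \<psi> n -` {..\<delta>} \<inter> (topspace (X n) \<times> topspace (X n))" for n
    have R_borel: "R n \<in> sets (borel_of (prod_topology (X n) (X n)))" for n
      using measurable_sets[OF borel, of "{..\<delta>}" n] by (simp add: R_def)
    \<comment> \<open>Terms of a convergent series are eventually below \<open>\<delta>\<close>.
      Conversely, if they eventually are at most \<open>\<delta>\<close>, the series agrees from
      some point on with its truncation, which is summable by the choice of
      \<open>\<delta>\<close>.\<close>
    have E_tail: "(x, y) \<in> E \<longleftrightarrow> (\<exists>m. \<forall>n\<ge>m. (x n, y n) \<in> R n)" if xy: "x \<in> ?T" "y \<in> ?T" for x y
    proof -
      have R: "(x n, y n) \<in> R n \<longleftrightarrow> \<psi> n (x n, y n) \<le> \<delta>" for n
        using xy by (auto simp: R_def)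
      show ?thesis
        unfolding E_iff[OF xy] R
      proof
        assume "summable (\<lambda>n. \<psi> n (x n, y n))"
        then have "(\<lambda>n. \<psi> n (x n, y n)) \<longlonglongrightarrow> 0" by (rule summable_LIMSEQ_zero)
        then have "eventually (\<lambda>n. \<psi> n (x n, y n) < \<delta>) sequentially"
          using \<delta>(1) by (rule order_tendstoD)
        then show "\<exists>m. \<forall>n\<ge>m. \<psi> n (x n, y n) \<le> \<delta>"
          unfolding eventually_sequentially by (meson less_imp_le)
      next
        assume "\<exists>m. \<forall>n\<ge>m. \<psi> n (x n, y n) \<le> \<delta>"
        then have "eventually (\<lambda>n. (if \<psi> n (x n, y n) \<le> \<delta> then \<psi> n (x n, y n) else 0) = \<psi> n (x n, y n))
          sequentially"
          unfolding eventually_sequentially by auto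
        from summable_cong[OF this] show "summable (\<lambda>n. \<psi> n (x n, y n))"
          using \<delta>(2)[OF xy] by (rule iffD1)
      qed
    qed
    have "\<exists>N. \<forall>n\<ge>N. equiv (topspace (X n)) (R n)"
      by (rule tail_equiv[OF nonempty equiv E_tail]) (auto simp: R_def)
    then obtain N where N: "\<And>n. N \<le> n \<Longrightarrow> equiv (topspace (X n)) (R n)" by blast
    \<comment> \<open>The coordinates for which Silver's theorem provides a Cantor set. If
      \<open>I\<close> is finite, only countable quotients remain from some index on.\<close>
    define I where "I = {n. N \<le> n \<and> uncountable (topspace (X n) // R n)}"
    show ?thesis
    proof (cases "finite I")
      case True
      then obtain N' where N': "I \<subseteq> {..<N'}" using finite_nat_bounded by blast
      have "borel_reducible (product_topology X UNIV) E cantor_topology E0"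
      proof (rule tail_reducible_E0[where R = R and N = "max N N'", OF E_tail])
        fix n assume n: "max N N' \<le> n"
        then show "equiv (topspace (X n)) (R n)" using N by simp
        have "n \<notin> I" using n N' by auto
        then show "countable (topspace (X n) // R n)" using n by (simp add: I_def)
      qed (use R_borel in auto)
      then show ?thesis by blast
    next
      case False
      have "\<exists>g :: (nat \<Rightarrow> bool) \<Rightarrow> 'a. continuous_map cantor_topology (X n) g \<and>
          (\<forall>x y. x \<noteq> y \<longrightarrow> (g x, g y) \<notin> R n)" if "n \<in> I" for n
        using that by (intro silver Polish N R_borel) (simp_all add: I_def)
      then have "\<forall>n\<in>I. \<exists>g :: (nat \<Rightarrow> bool) \<Rightarrow> 'a. continuous_map cantor_topology (X n) g \<and>
          (\<forall>x y. x \<noteq> y \<longrightarrow> (g x, g y) \<notin> R n)"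
        by (rule ballI)
      from bchoice[OF this] obtain g :: "nat \<Rightarrow> (nat \<Rightarrow> bool) \<Rightarrow> 'a" where
        "\<forall>n\<in>I. continuous_map cantor_topology (X n) (g n) \<and> (\<forall>x y. x \<noteq> y \<longrightarrow> (g n x, g n y) \<notin> R n)"
        by (rule exE)
      then have g: "\<And>n. n \<in> I \<Longrightarrow> continuous_map cantor_topology (X n) (g n)"
        "\<And>n x y. n \<in> I \<Longrightarrow> x \<noteq> y \<Longrightarrow> (g n x, g n y) \<notin> R n"
        by simp_all
      have "borel_reducible cantor_topology E1 (product_topology X UNIV) E"
      proof (rule E1_reducible_tail[OF nonempty E_tail _ False g])
        show "(u, u) \<in> R n" if "N \<le> n" "u \<in> topspace (X n)" for n u
          using N[OF that(1)] that(2) by (auto simp: equiv_def refl_on_def)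
      qed
      then show ?thesis by blast
    qed
  qed
qed

end
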